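(* Let $\Gamma=(V,E)$ be an unbalanced distance-biregular graph with diameter $d=2r+2$ and girth deficiency two, and let $\mathcal A_d(k,l)$ be its adjacency algebra. Let $t$ be a zero of $F_r(X)$ and $U_t$ the irreducible 2-dimensional representation of $\mathcal A_d(k,l)$ associated with $t$. Then the multiplicity $m_t$ of $U_t$ as a submodule of the standard module $\mathbb C^E$ is $$m_t=|E|\,\frac{t^2-4kl}{(t-kl-1)\bigl((2r+1)(t+k+l)+l-k\bigr)}.$$
   Context: All graphs are finite, undirected and simple. For a connected graph $\Gamma$ and a vertex $u$, $\Gamma_i(u)$ is the set of vertices at distance $i$ from $u$, and $\varepsilon(u)$ is the eccentricity of $u$. A connected bipartite graph with bipartition classes $A$, $B$ is distance-biregular if, for every vertex $u$, every $0\le i\le\varepsilon(u)$ and every $v\in\Gamma_i(u)$, the numbers $|\Gamma_{i+1}(u)\cap\Gamma_1(v)|$ and $|\Gamma_{i-1}(u)\cap\Gamma_1(v)|$ depend only on $i$ and on the class containing $u$. All vertices of $A$ (resp. $B$) then have the same eccentricity $d_A$ (resp. $d_B$). The graph is unbalanced if $d_A\ne d_B$; it has girth deficiency two if its girth is $2d-2$, where $d$ is the diameter. In the unbalanced case the classes are labelled so that $d=d_A>d_B$; it is known that then $d$ is even, and we write $d=2r+2$ ($r\ge1$). The degree of the vertices of $A$ is $k+1$ and the degree of the vertices of $B$ is $l+1$. Let $M,N$ be the $\{0,1\}$-matrices indexed by $E\times E$ with $M_{e,f}=1$ iff $e\neq f$ and $e,f$ share their vertex in $A$, and $N_{e,f}=1$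 iff $e\ne f$ and $e,f$ share their vertex in $B$. The adjacency algebra $\mathcal A_d(k,l)$ is the subalgebra of $\mathrm{Mat}_E(\mathbb C)$ generated by $I,M,N$; it is closed under conjugate transpose, and its standard module is $\mathbb C^E$ with action by left multiplication. This module is a direct sum of irreducible submodules, and the multiplicity of an irreducible representation $U$ is the number of summands isomorphic to $U$. The polynomials $F_i(X)\in\mathbb Z[X]$ are defined by $F_0(X)=1$, $F_1(X)=X+k$, $F_{i+2}(X)=XF_{i+1}(X)-kl\,F_i(X)$ for $i\ge0$. For a zero $t$ of $F_r(X)$, the associated representation $U_t=\mathbb C^2$ is given by $\rho_t(M)=\begin{pmatrix} k & 0 \\ 0 & -1 \end{pmatrix}$ and $\rho_t(N)=\begin{pmatrix} x & z \\ z & y \end{pmatrix}$, where $x=\frac{t+l-1}{k+1}$, $y=\frac{kl-k-t}{k+1}$ and $z$ is a fixed complex number with $z^2=\frac{(1+kl-t)(t+k+l)}{(k+1)^2}$. *)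

theory Defs
  imports
    "HOL-Analysis.Analysis"
    "HOL-Computational_Algebra.Polynomial"
    "HOL-Library.Extended_Nat"
    "HOL-Library.FuncSet"
    "HOL-Library.Function_Algebras"
begin

section \<open>Finite simple graphs\<close>

text \<open>A graph is given by a vertex set \<open>V\<close> and a set \<open>E\<close> of two-element subsets of \<open>V\<close>.\<close>

definition simple_graph :: "'v set \<Rightarrow> 'v set set \<Rightarrow> bool" where
  "simple_graph V E \<longleftrightarrow> finite V \<and> (\<forall>e\<in>E. e \<subseteq> V \<and> card e = 2)"

definition adj_rel :: "'v set set \<Rightarrow> 'v rel" where
  "adj_rel E = {(u, v). {u, v} \<in> E}"

definition connected_graph :: "'v set \<Rightarrow> 'v set set \<Rightarrow> bool" where
  "connected_graph V E \<longleftrightarrow> V \<noteq> {} \<and> (\<forall>u\<in>V. \<forall>v\<in>V. (u, v) \<in> (adj_rel E)\<^sup>*)"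

definition degree_in :: "'v set set \<Rightarrow> 'v \<Rightarrow> nat" where
  "degree_in E u = card {e\<in>E. u \<in> e}"

text \<open>Length of a shortest walk; only meaningful for vertices in the same component.\<close>

definition gdist :: "'v set set \<Rightarrow> 'v \<Rightarrow> 'v \<Rightarrow> nat" where
  "gdist E u v = (LEAST n. (u, v) \<in> adj_rel E ^^ n)"

definition at_dist :: "'v set \<Rightarrow> 'v set set \<Rightarrow> nat \<Rightarrow> 'v \<Rightarrow> 'v set" where
  "at_dist V E i u = {v\<in>V. gdist E u v = i}"

definition ecc :: "'v set \<Rightarrow> 'v set set \<Rightarrow> 'v \<Rightarrow> nat" where
  "ecc V E u = Max (gdist E u ` V)"

definition graph_diameter :: "'v set \<Rightarrow> 'v set set \<Rightarrow> nat" where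
  "graph_diameter V E = Max (ecc V E ` V)"

definition is_cycle :: "'v set set \<Rightarrow> 'v list \<Rightarrow> bool" where
  "is_cycle E c \<longleftrightarrow> 3 \<le> length c \<and> distinct c \<and>
     (\<forall>i. Suc i < length c \<longrightarrow> {c ! i, c ! Suc i} \<in> E) \<and> {last c, hd c} \<in> E"

text \<open>The girth is infinite for a forest.\<close>

definition girth :: "'v set set \<Rightarrow> enat" where
  "girth E = (INF c\<in>{c. is_cycle E c}. enat (length c))"

section \<open>Distance-biregular graphs\<close>

definition bipartition :: "'v set \<Rightarrow> 'v set set \<Rightarrow> 'v set \<Rightarrow> 'v set \<Rightarrow> bool" where
  "bipartition V E A B \<longleftrightarrow> A \<inter> B = {} \<and> A \<union> B = V \<and>
     (\<forall>e\<in>E. \<exists>a\<in>A. \<exists>b\<in>B. e = {a, b})"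

text \<open>For \<open>i = 0\<close> the truncated \<open>i - 1\<close> is harmless: then \<open>v = u\<close>, and both \<open>\<Gamma>\<^sub>0(u) \<inter> \<Gamma>\<^sub>1(u)\<close>
  and \<open>\<Gamma>\<^sub>-\<^sub>1(u) \<inter> \<Gamma>\<^sub>1(u)\<close> are empty.\<close>

definition distance_biregular ::
    "'v set \<Rightarrow> 'v set set \<Rightarrow> 'v set \<Rightarrow> 'v set \<Rightarrow> bool" where
  "distance_biregular V E A B \<longleftrightarrow>
     simple_graph V E \<and> connected_graph V E \<and> bipartition V E A B \<and>
     (\<forall>C\<in>{A, B}. \<exists>b c :: nat \<Rightarrow> nat. \<forall>u\<in>C. \<forall>i\<le>ecc V E u. \<forall>v\<in>at_dist V E i u.
        card (at_dist V E (i + 1) u \<inter> at_dist V E 1 v) = b i \<and>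
        card (at_dist V E (i - 1) u \<inter> at_dist V E 1 v) = c i)"

text \<open>In a distance-biregular graph all vertices of a class \<open>C\<close> have the same eccentricity;
  the maximum below is this common value.\<close>

definition class_ecc :: "'v set \<Rightarrow> 'v set set \<Rightarrow> 'v set \<Rightarrow> nat" where
  "class_ecc V E C = Max (ecc V E ` C)"

definition girth_deficiency_two :: "'v set \<Rightarrow> 'v set set \<Rightarrow> bool" where
  "girth_deficiency_two V E \<longleftrightarrow> girth E = enat (2 * graph_diameter V E - 2)"

section \<open>The standard module and the adjacency algebra\<close>

text \<open>Vectors in \<open>\<complex>\<^sup>E\<close> and matrices in \<open>Mat\<^sub>E(\<complex>)\<close> are functions which vanish outside \<open>E\<close>
  and \<open>E \<times> E\<close> respectively; addition of functions is pointwise. The pointwise product of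
  functions from the imported library is not used.\<close>

type_synonym 'e vector_on = "'e \<Rightarrow> complex"
type_synonym 'e matrix_on = "'e \<Rightarrow> 'e \<Rightarrow> complex"

definition vec_space :: "'e set \<Rightarrow> 'e vector_on set" where
  "vec_space E = {v. \<forall>e. e \<notin> E \<longrightarrow> v e = 0}"

definition vec_scale :: "complex \<Rightarrow> 'e vector_on \<Rightarrow> 'e vector_on" where
  "vec_scale c v = (\<lambda>e. c * v e)"

interpretation edge_space: vector_space vec_scale
  by unfold_locales (auto simp: vec_scale_def fun_eq_iff algebra_simps)

definition mat_one :: "'e set \<Rightarrow> 'e matrix_on" where
  "mat_one E = (\<lambda>e f. if e \<in> E \<and> e = f then 1 else 0)"

definition mat_scale :: "complex \<Rightarrow> 'e matrix_on \<Rightarrow> 'e matrix_on" where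
  "mat_scale c P = (\<lambda>e f. c * P e f)"

definition mat_mult :: "'e set \<Rightarrow> 'e matrix_on \<Rightarrow> 'e matrix_on \<Rightarrow> 'e matrix_on" where
  "mat_mult E P Q = (\<lambda>e f. \<Sum>g\<in>E. P e g * Q g f)"

definition mat_act :: "'e set \<Rightarrow> 'e matrix_on \<Rightarrow> 'e vector_on \<Rightarrow> 'e vector_on" where
  "mat_act E P v = (\<lambda>e. \<Sum>f\<in>E. P e f * v f)"

text \<open>\<open>share_mat E A\<close> is the matrix \<open>M\<close> and \<open>share_mat E B\<close> is the matrix \<open>N\<close>.\<close>

definition share_mat :: "'v set set \<Rightarrow> 'v set \<Rightarrow> 'v set matrix_on" where
  "share_mat E C =
     (\<lambda>e f. if e \<in> E \<and> f \<in> E \<and> e \<noteq> f \<and> e \<inter> f \<inter> C \<noteq> {} then 1 else 0)"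

inductive_set adj_algebra :: "'v set set \<Rightarrow> 'v set \<Rightarrow> 'v set \<Rightarrow> 'v set matrix_on set"
  for E :: "'v set set" and A B :: "'v set" where
  one: "mat_one E \<in> adj_algebra E A B"
| genM: "share_mat E A \<in> adj_algebra E A B"
| genN: "share_mat E B \<in> adj_algebra E A B"
| add: "P \<in> adj_algebra E A B \<Longrightarrow> Q \<in> adj_algebra E A B \<Longrightarrow> P + Q \<in> adj_algebra E A B"
| scale: "P \<in> adj_algebra E A B \<Longrightarrow> mat_scale c P \<in> adj_algebra E A B"
| mult: "P \<in> adj_algebra E A B \<Longrightarrow> Q \<in> adj_algebra E A B \<Longrightarrow> mat_mult E P Q \<in> adj_algebra E A B"

section \<open>Submodules, decompositions and multiplicities\<close>

text \<open>Below, \<open>\<A>\<close> stands for a subalgebra of \<open>Mat\<^sub>E(\<complex>)\<close>.\<close>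

definition submodule_on :: "'e set \<Rightarrow> 'e matrix_on set \<Rightarrow> 'e vector_on set \<Rightarrow> bool" where
  "submodule_on E \<A> W \<longleftrightarrow> W \<subseteq> vec_space E \<and> edge_space.subspace W \<and>
     (\<forall>P\<in>\<A>. \<forall>w\<in>W. mat_act E P w \<in> W)"

definition irreducible_submodule ::
    "'e set \<Rightarrow> 'e matrix_on set \<Rightarrow> 'e vector_on set \<Rightarrow> bool" where
  "irreducible_submodule E \<A> W \<longleftrightarrow> submodule_on E \<A> W \<and> W \<noteq> {0} \<and>
     (\<forall>U. submodule_on E \<A> U \<and> U \<subseteq> W \<longrightarrow> U = {0} \<or> U = W)"

text \<open>The standard module is the internal direct sum of the irreducible submodules in \<open>D\<close>.
  Nonzero summands of a direct sum are distinct, so a set of summands suffices.\<close>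

definition irreducible_decomposition ::
    "'e set \<Rightarrow> 'e matrix_on set \<Rightarrow> 'e vector_on set set \<Rightarrow> bool" where
  "irreducible_decomposition E \<A> D \<longleftrightarrow> finite D \<and>
     (\<forall>W\<in>D. irreducible_submodule E \<A> W) \<and>
     (\<forall>v\<in>vec_space E. \<exists>!w. w \<in> (\<Pi>\<^sub>E W\<in>D. W) \<and> v = (\<Sum>W\<in>D. w W))"

definition algebra_rep ::
    "'e set \<Rightarrow> 'e matrix_on set \<Rightarrow> ('e matrix_on \<Rightarrow> complex ^ 'n ^ 'n) \<Rightarrow> bool" where
  "algebra_rep E \<A> \<rho> \<longleftrightarrow> \<rho> (mat_one E) = mat 1 \<and>
     (\<forall>P\<in>\<A>. \<forall>Q\<in>\<A>. \<rho> (P + Q) = \<rho> P + \<rho> Q) \<and>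
     (\<forall>c. \<forall>P\<in>\<A>. \<rho> (mat_scale c P) = (\<chi> i j. c * \<rho> P $ i $ j)) \<and>
     (\<forall>P\<in>\<A>. \<forall>Q\<in>\<A>. \<rho> (mat_mult E P Q) = \<rho> P ** \<rho> Q)"

definition submodule_iso_rep ::
    "'e set \<Rightarrow> 'e matrix_on set \<Rightarrow> ('e matrix_on \<Rightarrow> complex ^ 'n ^ 'n) \<Rightarrow> 'e vector_on set \<Rightarrow> bool"
  where
  "submodule_iso_rep E \<A> \<rho> W \<longleftrightarrow>
     (\<exists>\<phi> :: complex ^ 'n \<Rightarrow> 'e vector_on.
        Vector_Spaces.linear (*s) vec_scale \<phi> \<and> bij_betw \<phi> UNIV W \<and>
        (\<forall>P\<in>\<A>. \<forall>x. \<phi> (\<rho> P *v x) = mat_act E P (\<phi> x)))"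

text \<open>The description has a value only if a decomposition exists and all decompositions
  have the same number of summands isomorphic to the representation.\<close>

definition multiplicity_in_std ::
    "'e set \<Rightarrow> 'e matrix_on set \<Rightarrow> ('e matrix_on \<Rightarrow> complex ^ 'n ^ 'n) \<Rightarrow> nat" where
  "multiplicity_in_std E \<A> \<rho> =
     (THE m. \<exists>D. irreducible_decomposition E \<A> D \<and>
        m = card {W\<in>D. submodule_iso_rep E \<A> \<rho> W})"

section \<open>The polynomials and the two-dimensional representations\<close>

fun F_poly :: "nat \<Rightarrow> nat \<Rightarrow> nat \<Rightarrow> int poly" where
  "F_poly k l 0 = 1"
| "F_poly k l (Suc 0) = [:int k, 1:]"
| "F_poly k l (Suc (Suc i)) = [:0, 1:] * F_poly k l (Suc i) - [:int k * int l:] * F_poly k l i"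

definition rep_M :: "nat \<Rightarrow> complex ^ 2 ^ 2" where
  "rep_M k = vector [vector [of_nat k, 0], vector [0, -1]]"

definition rep_N :: "nat \<Rightarrow> nat \<Rightarrow> complex \<Rightarrow> complex \<Rightarrow> complex ^ 2 ^ 2" where
  "rep_N k l t z =
     (let x = (t + of_nat l - 1) / (of_nat k + 1);
          y = (of_nat k * of_nat l - of_nat k - t) / (of_nat k + 1)
      in vector [vector [x, z], vector [z, y]])"

text \<open>A representation is determined on the adjacency algebra by its values on the generators
  \<open>M\<close> and \<open>N\<close>, so the choice below only affects values outside the algebra; these
  do not enter \<open>submodule_iso_rep\<close>.\<close>

definition assoc_rep ::
    "'v set set \<Rightarrow> 'v set \<Rightarrow> 'v set \<Rightarrow> nat \<Rightarrow> nat \<Rightarrow> complex \<Rightarrow> complex \<Rightarrow>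
     'v set matrix_on \<Rightarrow> complex ^ 2 ^ 2" where
  "assoc_rep E A B k l t z =
     (SOME \<rho>. algebra_rep E (adj_algebra E A B) \<rho> \<and>
        \<rho> (share_mat E A) = rep_M k \<and> \<rho> (share_mat E B) = rep_N k l t z)"

end

theory Submission
  imports Defs
begin


text \<open>Let \<open>m = M + I\<close> and \<open>n = N + I\<close>, and write \<open>b\<^sub>e\<close> for the end of an edge \<open>e\<close> in \<open>B\<close>.
  The girth makes geodesics of length at most \<open>2r\<close> unique, so the \<open>E \<times> E\<close> matrices
  \<open>X\<^sub>i\<close> with entry 1 at \<open>(e, f)\<close> if \<open>b\<^sub>e\<close> and \<open>b\<^sub>f\<close> are at distance at most \<open>2i\<close>
  satisfy \<open>X\<^sub>0 = n\<close> and \<open>X\<^sub>i = F\<^sub>i(nm - k - l) n\<close> for \<open>i \<le> r\<close>, and \<open>X\<^sub>r = J\<close> since vertices of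
  \<open>B\<close> are at distance at most \<open>2r\<close>. Dividing \<open>F\<^sub>r\<close> by \<open>X - t\<close> in the basis of the \<open>F\<^sub>i\<close> gives a
  combination of the \<open>X\<^sub>i\<close> which, up to a scalar, is the projection onto the eigenspace of
  \<open>nm\<close> for \<open>t + k + l\<close>. It acts with rank one on the irreducible submodules isomorphic
  to \<open>U\<^sub>t\<close> and annihilates the others, so the multiplicity is its trace, which can be read off
  because all \<open>X\<^sub>i\<close> have unit diagonal. Positivity of the form \<open>\<langle>m w, w\<rangle>\<close> and \<open>k < l\<close>
  show that no denominator vanishes.\<close>

section \<open>Modules over self-adjoint matrix algebras\<close>

text \<open>Let Q be the quotient of F_r by X - t, taken at nm - k - l and multiplied by n, and let
  \<theta> = t + k + l. Then (nm - \<theta>) Q = J, so Q fails to be an eigenmatrix only through J.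
  Since nm J = (k + 1)(l + 1) J, a multiple of J repairs this: J + (t - kl - 1) Q is annihilated by
  nm - \<theta>. The same factor t - kl - 1 makes the Chebyshev sum on the diagonal telescope. On
  its own image the matrix acts as (t - kl - 1)(l + 1) times the derivative of F_r at t; the
  derivative identity for Chebyshev polynomials, taken at a zero of F_r, is the origin of 2r + 1 in
  the formula. One Chebyshev value survives both in the trace and in the derivative, and cancels.
  Multiplicity and representation are given by description and choice. The trace is the same number
  for every decomposition, which makes the multiplicity well defined, and the representation is read
  off from the submodule generated by one column of the eigenmatrix, so no presentation of the
  algebra is involved. The inequalities 0 < k < l come from a pair of vertices at distance 2r +
  2.\<close>

lemma sum_fun_apply:
  fixes f :: "'i \<Rightarrow> 'a \<Rightarrow> 'b::comm_monoid_add"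
  shows "(\<Sum>i\<in>I. f i) x = (\<Sum>i\<in>I. f i x)"
  by (induction I rule: infinite_finite_induct) auto

definition delta :: "'e \<Rightarrow> 'e vector_on" where
  "delta f = (\<lambda>e. if e = f then 1 else 0)"

lemma vec_space_expand:
  assumes "finite E" "v \<in> vec_space E"
  shows "v = (\<Sum>f\<in>E. vec_scale (v f) (delta f))"
  using assms
  by (auto simp: fun_eq_iff sum_fun_apply vec_scale_def delta_def vec_space_def
      if_distrib[of "\<lambda>x. _ * x"] cong: if_cong)

lemma vec_space_subspace: "edge_space.subspace (vec_space E)"
  by (auto simp: edge_space.subspace_def vec_space_def vec_scale_def)

lemma delta_in_vec_space: "f \<in> E \<Longrightarrow> delta f \<in> vec_space E"
  by (auto simp: delta_def vec_space_def)

lemma independent_finite: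
  assumes "finite E" "edge_space.independent S" "S \<subseteq> vec_space E"
  shows "finite S"
proof -
  have "v \<in> edge_space.span (delta ` E)" if "v \<in> vec_space E" for v
    by (subst vec_space_expand[OF assms(1) that])
       (intro edge_space.span_sum edge_space.span_scale edge_space.span_base imageI)
  then have "S \<subseteq> edge_space.span (delta ` E)" using assms by auto
  then show ?thesis using edge_space.independent_span_bound assms by blast
qed

text \<open>The space of all functions may be infinite-dimensional, so strict monotonicity is taken
  from bases inside \<open>vec_space E\<close>. The dimension is the induction measure in
  \<open>module_decomposition_exists\<close>.\<close>

lemma dim_psubset:
  assumes "finite E" "edge_space.subspace U" "edge_space.subspace W" "U \<subset> W" "W \<subseteq> vec_space E"
  shows "edge_space.dim U < edge_space.dim W"
proof -
  obtain w where w: "w \<in> W" "w \<notin> U" using assms by auto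
  obtain X where X: "X \<subseteq> U" "edge_space.independent X" "U \<subseteq> edge_space.span X"
      "card X = edge_space.dim U" by (rule edge_space.basis_exists)
  obtain Y where Y: "Y \<subseteq> W" "edge_space.independent Y" "W \<subseteq> edge_space.span Y"
      "card Y = edge_space.dim W" by (rule edge_space.basis_exists)
  have fin: "finite X" "finite Y"
    using independent_finite[OF assms(1)] X(1,2) Y(1,2) assms(4,5) by blast+
  have "edge_space.span X \<subseteq> U" using X(1) assms(2) by (rule edge_space.span_minimal)
  then have "edge_space.independent (insert w X)"
    using w X by (intro edge_space.independent_insertI) auto
  moreover have "insert w X \<subseteq> edge_space.span Y" using X w Y assms(4) by auto
  ultimately have "card (insert w X) \<le> card Y"
    using edge_space.independent_span_bound[OF fin(2)] by blast
  moreover have "w \<notin> X" using X w by auto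
  ultimately show ?thesis using X Y fin by simp
qed

section \<open>The Hermitian form on the standard module and orthogonal projection\<close>

definition herm :: "'e set \<Rightarrow> 'e vector_on \<Rightarrow> 'e vector_on \<Rightarrow> complex" where
  "herm E v w = (\<Sum>e\<in>E. v e * cnj (w e))"

lemma herm_add_left: "herm E (v + v') w = herm E v w + herm E v' w"
  by (simp add: herm_def algebra_simps sum.distrib)

lemma herm_scale_left: "herm E (vec_scale c v) w = c * herm E v w"
  by (simp add: herm_def vec_scale_def sum_distrib_left mult.assoc)

lemma herm_commute: "herm E v w = cnj (herm E w v)"
  by (simp add: herm_def mult.commute)

lemma herm_self_of_real: "herm E v v = of_real (\<Sum>e\<in>E. (cmod (v e))\<^sup>2)"
  by (simp only: herm_def complex_norm_square of_real_sum)

lemma herm_self_eq_0: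
  assumes "finite E" "v \<in> vec_space E" "herm E v v = 0"
  shows "v = 0"
proof -
  have "(\<Sum>e\<in>E. (cmod (v e))\<^sup>2) = 0"
    using assms(3) unfolding herm_self_of_real by (simp only: of_real_eq_0_iff)
  then have "\<forall>e\<in>E. v e = 0" using assms(1) by (simp add: sum_nonneg_eq_0_iff)
  then show ?thesis using assms(2) by (auto simp: vec_space_def fun_eq_iff)
qed

lemma herm_orthogonal_span:
  assumes "x \<in> edge_space.span S" "\<forall>s\<in>S. herm E q s = 0"
  shows "herm E q x = 0"
proof -
  have "edge_space.subspace {x. herm E q x = 0}"
    by (auto simp: edge_space.subspace_def herm_def vec_scale_def algebra_simps sum.distrib
        simp flip: sum_distrib_left)
  moreover have "S \<subseteq> {x. herm E q x = 0}" using assms(2) by auto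
  ultimately show ?thesis using assms(1) edge_space.span_minimal by blast
qed

text \<open>Gram-Schmidt within one induction: the hypothesis is applied to \<open>v\<close> and to
  the new vector \<open>b\<close>, and the residual of \<open>v\<close> is corrected along the
  residual \<open>q'\<close> of \<open>b\<close>, which keeps it orthogonal to the old
  vectors.\<close>

lemma orthogonal_projection:
  assumes "finite E" "finite S" "S \<subseteq> vec_space E" "v \<in> vec_space E"
  shows "\<exists>p q. v = p + q \<and> p \<in> edge_space.span S \<and> (\<forall>s\<in>S. herm E q s = 0)"
  using assms(2,3,4)
proof (induction S arbitrary: v rule: finite_induct)
  case empty
  then show ?case by (intro exI[of _ 0] exI[of _ v]) (auto simp: edge_space.span_zero)
next
  case (insert b S)
  obtain p q where v: "v = p + q" "p \<in> edge_space.span S" "\<forall>s\<in>S. herm E q s = 0"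
    using insert by blast
  obtain p' q' where b: "b = p' + q'" "p' \<in> edge_space.span S" "\<forall>s\<in>S. herm E q' s = 0"
    using insert by blast
  have S: "edge_space.span S \<subseteq> vec_space E"
    using insert.prems vec_space_subspace by (intro edge_space.span_minimal) auto
  have q': "q' \<in> vec_space E"
  proof -
    have "q' = b - p'" using b by simp
    moreover have "b \<in> vec_space E" "p' \<in> vec_space E" using S b(2) insert.prems by auto
    ultimately show ?thesis by (simp only: edge_space.subspace_diff[OF vec_space_subspace])
  qed
  \<comment> \<open>If \<open>q'\<close> is zero, the quotient is zero by convention and
    \<open>q\<close> itself is kept.\<close>
  define c where "c = herm E q q' / herm E q' q'"
  define r where "r = q + vec_scale (- c) q'"
  have r: "herm E r s = 0" if "s \<in> S" for s
    using that v(3) b(3) unfolding r_def herm_add_left herm_scale_left by simp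
  have rq: "herm E r q' = 0"
  proof (cases "q' = 0")
    case True then show ?thesis by (simp add: herm_def)
  next
    case False
    then have "herm E q' q' \<noteq> 0" using herm_self_eq_0 assms(1) q' by blast
    then show ?thesis 
      unfolding r_def c_def herm_add_left herm_scale_left by simp
  qed
  have rp: "herm E r p' = 0" using b(2) r by (intro herm_orthogonal_span) auto
  have "herm E r b = 0"
    using rp rq herm_add_left[of E p' q' r] herm_commute[of E r]
    by (simp add: b(1))
  moreover have "q' \<in> edge_space.span (insert b S)"
  proof -
    have "q' = b - p'" using b by simp
    moreover have "p' \<in> edge_space.span (insert b S)"
      using b edge_space.span_mono[of S "insert b S"] by auto
    ultimately show ?thesis by (metis edge_space.span_base edge_space.span_diff insertI1)
  qed
  then have "p + vec_scale c q' \<in> edge_space.span (insert b S)"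
    using v edge_space.span_mono[of S "insert b S"]
    by (auto intro!: edge_space.span_add edge_space.span_scale)
  moreover have "v = (p + vec_scale c q') + r"
    using v by (auto simp: r_def fun_eq_iff vec_scale_def)
  ultimately show ?case using r by blast
qed

section \<open>Adjoints and complete reducibility\<close>

definition adjoint_mat :: "'e matrix_on \<Rightarrow> 'e matrix_on" where
  "adjoint_mat P = (\<lambda>e f. cnj (P f e))"

lemma herm_mat_act: "herm E (mat_act E P v) w = herm E v (mat_act E (adjoint_mat P) w)"
proof -
  have "herm E (mat_act E P v) w = (\<Sum>e\<in>E. \<Sum>f\<in>E. P e f * v f * cnj (w e))"
    by (simp add: herm_def mat_act_def sum_distrib_right)
  also have "\<dots> = (\<Sum>f\<in>E. \<Sum>e\<in>E. P e f * v f * cnj (w e))" by (rule sum.swap)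
  also have "\<dots> = herm E v (mat_act E (adjoint_mat P) w)"
    by (simp add: herm_def mat_act_def adjoint_mat_def sum_distrib_left mult_ac)
  finally show ?thesis .
qed

text \<open>Uniqueness is stated as the vanishing of zero sums and is relative to a submodule
  \<open>W\<close>: this form composes along direct sums and is free of extensional families.
  \<open>irreducible_decomposition_if\<close> translates it back.\<close>

definition module_decomposition ::
    "'e set \<Rightarrow> 'e matrix_on set \<Rightarrow> 'e vector_on set \<Rightarrow> 'e vector_on set set \<Rightarrow> bool" where
  "module_decomposition E \<A> W D \<longleftrightarrow> finite D \<and>
     (\<forall>U\<in>D. irreducible_submodule E \<A> U \<and> U \<subseteq> W) \<and>
     (\<forall>v\<in>W. \<exists>w. (\<forall>U\<in>D. w U \<in> U) \<and> v = (\<Sum>U\<in>D. w U)) \<and>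
     (\<forall>w. (\<forall>U\<in>D. w U \<in> U) \<and> (\<Sum>U\<in>D. w U) = 0 \<longrightarrow> (\<forall>U\<in>D. w U = 0))"

lemma
  assumes "module_decomposition E \<A> W D"
  shows module_decomposition_finite: "finite D"
    and module_decomposition_irreducible: "\<And>U. U \<in> D \<Longrightarrow> irreducible_submodule E \<A> U"
    and module_decomposition_subset: "\<And>U. U \<in> D \<Longrightarrow> U \<subseteq> W"
    and module_decomposition_ex:
      "\<And>v. v \<in> W \<Longrightarrow> \<exists>w. (\<forall>U\<in>D. w U \<in> U) \<and> v = (\<Sum>U\<in>D. w U)"
    and module_decomposition_zero:
      "\<And>w U. (\<And>U. U \<in> D \<Longrightarrow> w U \<in> U) \<Longrightarrow> (\<Sum>U\<in>D. w U) = 0 \<Longrightarrow> U \<in> D \<Longrightarrow> w U = 0"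
proof -
  note parts = assms[unfolded module_decomposition_def]
  show "finite D" using parts by (rule conjunct1)
  show "irreducible_submodule E \<A> U" "U \<subseteq> W" if "U \<in> D" for U
    using bspec[OF parts[THEN conjunct2, THEN conjunct1] that] by auto
  show "\<exists>w. (\<forall>U\<in>D. w U \<in> U) \<and> v = (\<Sum>U\<in>D. w U)" if "v \<in> W" for v
    using parts[THEN conjunct2, THEN conjunct2, THEN conjunct1] that by (rule bspec)
  show "w U = 0" if "\<And>U. U \<in> D \<Longrightarrow> w U \<in> U" "(\<Sum>U\<in>D. w U) = 0" "U \<in> D" for w U
    using parts[THEN conjunct2, THEN conjunct2, THEN conjunct2, THEN spec, of w] that by blast
qed

lemma submodule_subspace: "submodule_on E \<A> W \<Longrightarrow> edge_space.subspace W"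
  by (simp add: submodule_on_def)

lemma module_decomposition_sum:
  assumes D1: "module_decomposition E \<A> W1 D1" and D2: "module_decomposition E \<A> W2 D2"
    and W: "edge_space.subspace W1" "edge_space.subspace W2" "W1 \<inter> W2 \<subseteq> {0}"
    and sub: "W1 \<subseteq> W" "W2 \<subseteq> W" "\<And>v. v \<in> W \<Longrightarrow> \<exists>p\<in>W1. \<exists>q\<in>W2. v = p + q"
  shows "module_decomposition E \<A> W (D1 \<union> D2)"
proof -
  have fin: "finite D1" "finite D2"
    using D1 D2 by (simp_all add: module_decomposition_finite)
  \<comment> \<open>The summands form a set, so a summand common to both parts would be counted only
    once in the union.\<close>
  have disj: "D1 \<inter> D2 = {}"
  proof (rule ccontr)
    assume "D1 \<inter> D2 \<noteq> {}"
    then obtain U where U: "U \<in> D1" "U \<in> D2" by auto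
    then have "U \<subseteq> {0}" "irreducible_submodule E \<A> U"
      using module_decomposition_subset[OF D1 U(1)] module_decomposition_subset[OF D2 U(2)] W(3)
        module_decomposition_irreducible[OF D1 U(1)] by auto
    then show False
      using edge_space.subspace_0[of U] by (auto simp: irreducible_submodule_def submodule_on_def)
  qed
  have split: "(\<Sum>U\<in>D1 \<union> D2. w U) = (\<Sum>U\<in>D1. w U) + (\<Sum>U\<in>D2. w U)"
    for w :: "'a vector_on set \<Rightarrow> 'a vector_on"
    using fin disj by (rule sum.union_disjoint)
  have "\<exists>w. (\<forall>U\<in>D1 \<union> D2. w U \<in> U) \<and> v = (\<Sum>U\<in>D1 \<union> D2. w U)" if v: "v \<in> W" for v
  proof -
    obtain p q where pq: "p \<in> W1" "q \<in> W2" "v = p + q" using sub v by blast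
    obtain w1 where w1: "\<forall>U\<in>D1. w1 U \<in> U" "p = (\<Sum>U\<in>D1. w1 U)"
      using module_decomposition_ex[OF D1 pq(1)] by blast
    obtain w2 where w2: "\<forall>U\<in>D2. w2 U \<in> U" "q = (\<Sum>U\<in>D2. w2 U)"
      using module_decomposition_ex[OF D2 pq(2)] by blast
    define w where "w U = (if U \<in> D1 then w1 U else w2 U)" for U
    have "(\<Sum>U\<in>D2. w U) = (\<Sum>U\<in>D2. w2 U)"
      using disj by (intro sum.cong) (auto simp: w_def)
    moreover have "(\<Sum>U\<in>D1. w U) = (\<Sum>U\<in>D1. w1 U)" by (simp add: w_def)
    ultimately have "v = (\<Sum>U\<in>D1 \<union> D2. w U)" using pq w1 w2 by (simp add: split)
    moreover have "\<forall>U\<in>D1 \<union> D2. w U \<in> U" using w1 w2 by (auto simp: w_def)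
    ultimately show ?thesis by blast
  qed
  moreover have "\<forall>U\<in>D1 \<union> D2. w U = 0"
    if w: "\<forall>U\<in>D1 \<union> D2. w U \<in> U" "(\<Sum>U\<in>D1 \<union> D2. w U) = 0" for w
  proof -
    have 1: "(\<Sum>U\<in>D1. w U) \<in> W1"
      using w module_decomposition_subset[OF D1] by (intro edge_space.subspace_sum W) blast
    have 2: "(\<Sum>U\<in>D2. w U) \<in> W2"
      using w module_decomposition_subset[OF D2] by (intro edge_space.subspace_sum W) blast
    have eq: "(\<Sum>U\<in>D1. w U) = - (\<Sum>U\<in>D2. w U)"
      using w(2) unfolding split by (simp add: eq_neg_iff_add_eq_0)
    have "- (\<Sum>U\<in>D2. w U) \<in> W2" by (rule edge_space.subspace_neg[OF W(2) 2])
    then have "(\<Sum>U\<in>D1. w U) = 0" using 1 W(3) eq by auto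
    moreover from this eq have "(\<Sum>U\<in>D2. w U) = 0" by simp
    ultimately show ?thesis
      using w(1) module_decomposition_zero[OF D1, of w] module_decomposition_zero[OF D2, of w]
      by blast
  qed
  moreover have "\<forall>U\<in>D1 \<union> D2. irreducible_submodule E \<A> U \<and> U \<subseteq> W"
    using module_decomposition_subset[OF D1] module_decomposition_subset[OF D2] sub(1,2)
      module_decomposition_irreducible[OF D1] module_decomposition_irreducible[OF D2]
    by (metis UnE order_trans)
  ultimately show ?thesis using fin unfolding module_decomposition_def by simp blast
qed

text \<open>Moving a matrix of \<open>\<A>\<close> to the other argument of the form gives its
  adjoint, which preserves \<open>U\<close>; hence the orthogonal complement of \<open>U\<close> in
  \<open>W\<close> is invariant.\<close>

lemma submodule_complement:
  assumes "finite E" and adj: "\<And>P. P \<in> \<A> \<Longrightarrow> adjoint_mat P \<in> \<A>"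
    and W: "submodule_on E \<A> W" and U: "submodule_on E \<A> U" "U \<subseteq> W"
  shows "\<exists>U'. submodule_on E \<A> U' \<and> U' \<subseteq> W \<and> U \<inter> U' \<subseteq> {0} \<and>
    (\<forall>v\<in>W. \<exists>p\<in>U. \<exists>q\<in>U'. v = p + q)"
proof -
  define U' where "U' = {v\<in>W. \<forall>u\<in>U. herm E v u = 0}"
  have sW: "edge_space.subspace W" and sU: "edge_space.subspace U"
    and vW: "W \<subseteq> vec_space E" using W U by (auto simp: submodule_on_def)
  have "edge_space.subspace U'"
    using sW by (auto simp: edge_space.subspace_def U'_def herm_add_left herm_scale_left)
      (simp add: herm_def)
  moreover have "mat_act E P v \<in> U'" if "P \<in> \<A>" "v \<in> U'" for P v
    using that adj W U(1) by (auto simp: U'_def submodule_on_def herm_mat_act)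
  ultimately have "submodule_on E \<A> U'" using vW by (auto simp: submodule_on_def U'_def)
  moreover have "U \<inter> U' \<subseteq> {0}"
    using herm_self_eq_0[OF assms(1)] vW by (auto simp: U'_def)
  moreover have "\<exists>p\<in>U. \<exists>q\<in>U'. v = p + q" if v: "v \<in> W" for v
  proof -
    obtain X where X: "X \<subseteq> U" "edge_space.independent X" "U \<subseteq> edge_space.span X"
      by (rule edge_space.maximal_independent_subset)
    have "finite X" using independent_finite[OF assms(1) X(2)] X(1) U(2) vW by blast
    then obtain p q where pq: "v = p + q" "p \<in> edge_space.span X" "\<forall>s\<in>X. herm E q s = 0"
      using orthogonal_projection[OF assms(1), of X v] X(1) U(2) vW v by blast
    have p: "p \<in> U" using pq X(1) edge_space.span_minimal[OF _ sU] by blast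
    have "q = v - p" using pq by simp
    then have "q \<in> W" using edge_space.subspace_diff[OF sW v] p U(2) by auto
    moreover have "herm E q u = 0" if "u \<in> U" for u
    proof -
      have "u \<in> edge_space.span X" using X that by auto
      then show ?thesis using pq(3) by (rule herm_orthogonal_span)
    qed
    ultimately show ?thesis using p pq by (auto simp: U'_def)
  qed
  moreover have "U' \<subseteq> W" by (auto simp: U'_def)
  ultimately show ?thesis by (intro exI[of _ U'] conjI ballI) simp_all
qed

lemma module_decomposition_exists:
  assumes "finite E" and adj: "\<And>P. P \<in> \<A> \<Longrightarrow> adjoint_mat P \<in> \<A>"
    and "submodule_on E \<A> W"
  shows "\<exists>D. module_decomposition E \<A> W D"
  using assms(3)
proof (induction "edge_space.dim W" arbitrary: W rule: less_induct)
  case less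
  consider "W = {0}" | "irreducible_submodule E \<A> W"
    | U where "submodule_on E \<A> U" "U \<subseteq> W" "U \<noteq> {0}" "U \<noteq> W"
    using less.prems unfolding irreducible_submodule_def by blast
  then show ?case
  proof cases
    case 1
    then have "module_decomposition E \<A> W {}" by (auto simp: module_decomposition_def)
    then show ?thesis by blast
  next
    case 2
    then have "module_decomposition E \<A> W {W}" by (auto simp: module_decomposition_def)
    then show ?thesis by blast
  next
    case 3
    obtain U' where U': "submodule_on E \<A> U'" "U' \<subseteq> W" "U \<inter> U' \<subseteq> {0}"
      "\<forall>v\<in>W. \<exists>p\<in>U. \<exists>q\<in>U'. v = p + q"
      using submodule_complement[OF assms(1) adj less.prems 3(1,2)] by blast
    have "U' \<noteq> W"
      using 3 U'(3) edge_space.subspace_0[OF submodule_subspace[OF 3(1)]] by blast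
    moreover have vs: "W \<subseteq> vec_space E" using less.prems by (simp add: submodule_on_def)
    ultimately have "edge_space.dim U < edge_space.dim W" "edge_space.dim U' < edge_space.dim W"
      using 3 U' less.prems by (auto intro!: dim_psubset[OF assms(1)] submodule_subspace)
    then obtain D1 D2 where "module_decomposition E \<A> U D1" "module_decomposition E \<A> U' D2"
      using less.hyps[OF _ 3(1)] less.hyps[OF _ U'(1)] by blast
    then have "module_decomposition E \<A> W (D1 \<union> D2)"
      by (rule module_decomposition_sum)
        (use 3 U' in \<open>simp_all add: submodule_subspace\<close>)
    then show ?thesis by blast
  qed
qed

lemma irreducible_decomposition_if:
  assumes "module_decomposition E \<A> (vec_space E) D"
  shows "irreducible_decomposition E \<A> D"
  unfolding irreducible_decomposition_def
proof (intro conjI ballI)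
  show "finite D" using assms by (simp add: module_decomposition_def)
  show "irreducible_submodule E \<A> W" if "W \<in> D" for W
    using assms that by (simp add: module_decomposition_def)
  fix v assume "v \<in> vec_space E"
  then obtain w where w: "\<forall>U\<in>D. w U \<in> U" "v = (\<Sum>U\<in>D. w U)"
    using module_decomposition_ex[OF assms] by blast
  show "\<exists>!w. w \<in> (\<Pi>\<^sub>E W\<in>D. W) \<and> v = (\<Sum>W\<in>D. w W)"
  proof (rule ex1I[of _ "restrict w D"])
    show "restrict w D \<in> (\<Pi>\<^sub>E W\<in>D. W) \<and> v = (\<Sum>W\<in>D. restrict w D W)" using w by auto
    fix w' assume w': "w' \<in> (\<Pi>\<^sub>E W\<in>D. W) \<and> v = (\<Sum>W\<in>D. w' W)"
    have "(\<Sum>U\<in>D. w' U - w U) = 0" using w w' by (simp add: sum_subtractf)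
    moreover have "w' U - w U \<in> U" if "U \<in> D" for U
    proof -
      have "edge_space.subspace U"
        using assms that
        by (auto simp: module_decomposition_def irreducible_submodule_def submodule_on_def)
      moreover have "w' U \<in> U" using w' that by (auto simp: PiE_def Pi_def)
      ultimately show ?thesis using w that by (auto intro: edge_space.subspace_diff)
    qed
    ultimately have "\<forall>U\<in>D. w' U - w U = 0"
      using module_decomposition_zero[OF assms, of "\<lambda>U. w' U - w U"] by blast
    moreover have "w' \<in> extensional D" using w' by (simp add: PiE_def)
    ultimately show "w' = restrict w D" by (intro extensionalityI[of w' D]) auto
  qed
qed

lemma irreducible_decomposition_zero:
  assumes D: "irreducible_decomposition E \<A> D"
    and w: "\<forall>U\<in>D. w U \<in> U" "(\<Sum>U\<in>D. w U) = 0" and "U \<in> D"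
  shows "w U = 0"
proof -
  have "0 \<in> vec_space E" by (simp add: vec_space_def)
  then have uniq: "\<exists>!w. w \<in> (\<Pi>\<^sub>E W\<in>D. W) \<and> 0 = (\<Sum>W\<in>D. w W)"
    using D unfolding irreducible_decomposition_def by blast
  have zero: "0 \<in> W" if "W \<in> D" for W
    using D that edge_space.subspace_0
    by (auto simp: irreducible_decomposition_def irreducible_submodule_def submodule_on_def)
  have "restrict w D = restrict (\<lambda>_. 0) D"
  proof (rule ex1E[OF uniq])
    fix w' assume "\<forall>y. y \<in> (\<Pi>\<^sub>E W\<in>D. W) \<and> 0 = (\<Sum>W\<in>D. y W) \<longrightarrow> y = w'"
    moreover have "restrict w D \<in> (\<Pi>\<^sub>E W\<in>D. W) \<and> 0 = (\<Sum>W\<in>D. restrict w D W)"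
      using w by auto
    moreover have "restrict (\<lambda>_. 0) D \<in> (\<Pi>\<^sub>E W\<in>D. W) \<and> 0 = (\<Sum>W\<in>D. restrict (\<lambda>_. 0) D W)"
      using zero by auto
    ultimately show ?thesis by metis
  qed
  then show ?thesis using \<open>U \<in> D\<close> by (metis restrict_apply')
qed

section \<open>The action of matrices and the trace as a count of summands\<close>

lemma mat_act_add: "mat_act E P (v + w) = mat_act E P v + mat_act E P w"
  by (auto simp: mat_act_def fun_eq_iff algebra_simps sum.distrib)

lemma mat_act_scale: "mat_act E P (vec_scale c v) = vec_scale c (mat_act E P v)"
  by (auto simp: mat_act_def vec_scale_def fun_eq_iff sum_distrib_left mult_ac)

lemma mat_act_zero [simp]: "mat_act E P 0 = 0"
  by (auto simp: mat_act_def fun_eq_iff)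

lemma mat_act_sum: "mat_act E P (\<Sum>i\<in>I. v i) = (\<Sum>i\<in>I. mat_act E P (v i))"
  by (auto simp: fun_eq_iff mat_act_def sum_fun_apply sum_distrib_left intro: sum.swap)

lemma mat_act_mult: "mat_act E (mat_mult E P Q) v = mat_act E P (mat_act E Q v)"
proof
  fix e
  have "mat_act E (mat_mult E P Q) v e = (\<Sum>f\<in>E. \<Sum>g\<in>E. P e g * Q g f * v f)"
    by (simp add: mat_act_def mat_mult_def sum_distrib_right)
  also have "\<dots> = (\<Sum>g\<in>E. \<Sum>f\<in>E. P e g * Q g f * v f)" by (rule sum.swap)
  also have "\<dots> = mat_act E P (mat_act E Q v) e"
    by (simp add: mat_act_def sum_distrib_left mult.assoc)
  finally show "mat_act E (mat_mult E P Q) v e = mat_act E P (mat_act E Q v) e" .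
qed

lemma mat_act_plus_mat: "mat_act E (P + Q) v = mat_act E P v + mat_act E Q v"
  by (auto simp: mat_act_def fun_eq_iff algebra_simps sum.distrib)

lemma mat_act_scale_mat: "mat_act E (mat_scale c P) v = vec_scale c (mat_act E P v)"
  by (auto simp: mat_act_def mat_scale_def vec_scale_def fun_eq_iff sum_distrib_left mult.assoc)

lemma mat_act_one: "finite E \<Longrightarrow> v \<in> vec_space E \<Longrightarrow> mat_act E (mat_one E) v = v"
proof
  fix e assume "finite E" "v \<in> vec_space E"
  then have "mat_act E (mat_one E) v e = (\<Sum>f\<in>E. if e = f then v f else 0)"
    unfolding mat_act_def mat_one_def
    using \<open>v \<in> vec_space E\<close> by (intro sum.cong) (auto simp: vec_space_def)
  also have "\<dots> = v e" using \<open>finite E\<close> \<open>v \<in> vec_space E\<close> by (auto simp: vec_space_def)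
  finally show "mat_act E (mat_one E) v e = v e" .
qed

lemma mat_act_delta: "finite E \<Longrightarrow> f \<in> E \<Longrightarrow> mat_act E P (delta f) e = P e f"
  by (simp add: mat_act_def delta_def if_distrib[of "\<lambda>x. _ * x"] cong: if_cong)

text \<open>Writing the column of index \<open>f\<close> as
  \<open>\<Sum>i. c i f w\<^sub>i\<close>, idempotence says that the functionals \<open>c i\<close> are dual to the
  vectors \<open>w\<^sub>i\<close>.\<close>

lemma trace_eq_card:
  assumes "finite E" "finite I"
    and col: "\<And>f. f \<in> E \<Longrightarrow> \<exists>c. mat_act E P (delta f) = (\<Sum>i\<in>I. vec_scale (c i) (w i))"
    and w: "\<And>i. i \<in> I \<Longrightarrow> w i \<in> vec_space E" "\<And>i. i \<in> I \<Longrightarrow> mat_act E P (w i) = w i"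
    and indep: "\<And>c i. (\<Sum>i\<in>I. vec_scale (c i) (w i)) = 0 \<Longrightarrow> i \<in> I \<Longrightarrow> c i = 0"
  shows "(\<Sum>e\<in>E. P e e) = of_nat (card I)"
proof -
  obtain c where c: "\<And>f. f \<in> E \<Longrightarrow> mat_act E P (delta f) = (\<Sum>i\<in>I. vec_scale (c f i) (w i))"
    using col by metis
  have dual: "(\<Sum>f\<in>E. w i f * c f i) = 1" if i: "i \<in> I" for i
  proof -
    have "w i = mat_act E P (\<Sum>f\<in>E. vec_scale (w i f) (delta f))"
      using w i vec_space_expand[OF assms(1)] by metis
    also have "\<dots> = (\<Sum>f\<in>E. vec_scale (w i f) (\<Sum>j\<in>I. vec_scale (c f j) (w j)))"
      by (simp add: mat_act_sum mat_act_scale c)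
    finally have eq: "w i = (\<Sum>f\<in>E. vec_scale (w i f) (\<Sum>j\<in>I. vec_scale (c f j) (w j)))" .
    have *: "w i e = (\<Sum>f\<in>E. w i f * (\<Sum>j\<in>I. c f j * w j e))" for e
      using fun_cong[OF eq, of e] unfolding sum_fun_apply vec_scale_def .
    \<comment> \<open>\<open>w i\<close> is its own image and so has two expansions in the
      \<open>w j\<close>; \<open>d\<close> collects the differences of the coefficients, which
      vanish by independence.\<close>
    define d where "d j = (\<Sum>f\<in>E. w i f * c f j) - (if j = i then 1 else 0)" for j
    have "(\<Sum>j\<in>I. vec_scale (d j) (w j)) e = 0" for e
    proof -
      have "(\<Sum>j\<in>I. (\<Sum>f\<in>E. w i f * c f j) * w j e) = w i e"
        unfolding *[of e] sum_distrib_left sum_distrib_right mult.assoc by (rule sum.swap)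
      then show ?thesis using i assms(2)
        by (simp add: sum_fun_apply vec_scale_def d_def left_diff_distrib sum_subtractf
            if_distrib[of "\<lambda>x. x * _"] cong: if_cong)
    qed
    then have "(\<Sum>j\<in>I. vec_scale (d j) (w j)) = 0" by (auto simp: fun_eq_iff)
    from indep[OF this i] show ?thesis by (simp add: d_def)
  qed
  have "(\<Sum>e\<in>E. P e e) = (\<Sum>e\<in>E. \<Sum>i\<in>I. c e i * w i e)"
  proof (rule sum.cong[OF refl])
    fix e assume "e \<in> E"
    then have "P e e = mat_act E P (delta e) e" using assms(1) by (simp add: mat_act_delta)
    also have "\<dots> = (\<Sum>i\<in>I. c e i * w i e)"
      using c[OF \<open>e \<in> E\<close>] by (simp add: sum_fun_apply vec_scale_def)
    finally show "P e e = (\<Sum>i\<in>I. c e i * w i e)" .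
  qed
  also have "\<dots> = (\<Sum>i\<in>I. \<Sum>e\<in>E. w i e * c e i)"
    by (subst sum.swap) (simp add: mult.commute)
  also have "\<dots> = of_nat (card I)" by (simp add: dual)
  finally show ?thesis .
qed

text \<open>The components of \<open>delta f\<close> in summands without \<open>Q\<close> are
  killed, the others go to multiples of one fixed vector each. These fixed vectors are independent
  because the sum is direct, so \<open>trace_eq_card\<close> applies to them.\<close>

lemma trace_eq_card_summands:
  assumes fin: "finite E" and D: "irreducible_decomposition E \<A> D"
    and one: "\<And>W. W \<in> D \<Longrightarrow> Q W \<Longrightarrow>
      \<exists>w\<in>W. w \<noteq> 0 \<and> mat_act E P w = w \<and> (\<forall>v\<in>W. \<exists>c. mat_act E P v = vec_scale c w)"
    and zero: "\<And>W v. W \<in> D \<Longrightarrow> \<not> Q W \<Longrightarrow> v \<in> W \<Longrightarrow> mat_act E P v = 0"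
  shows "(\<Sum>e\<in>E. P e e) = of_nat (card {W\<in>D. Q W})"
proof -
  define I where "I = {W\<in>D. Q W}"
  have finD: "finite D" using D by (simp add: irreducible_decomposition_def)
  obtain x where x: "\<And>W. W \<in> I \<Longrightarrow> x W \<in> W" "\<And>W. W \<in> I \<Longrightarrow> x W \<noteq> 0"
    "\<And>W. W \<in> I \<Longrightarrow> mat_act E P (x W) = x W"
    "\<And>W. W \<in> I \<Longrightarrow> (\<forall>v\<in>W. \<exists>c. mat_act E P v = vec_scale c (x W))"
  proof -
    have "\<forall>W\<in>I. \<exists>w. w\<in>W \<and> w \<noteq> 0 \<and> mat_act E P w = w \<and> (\<forall>v\<in>W. \<exists>c. mat_act E P v = vec_scale c w)"
      using one unfolding I_def by blast
    then have "\<exists>x. \<forall>W\<in>I. x W \<in> W \<and> x W \<noteq> 0 \<and> mat_act E P (x W) = x W \<and>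
        (\<forall>v\<in>W. \<exists>c. mat_act E P v = vec_scale c (x W))"
      by (rule bchoice)
    then show ?thesis using that by blast
  qed
  have sub: "edge_space.subspace W" "W \<subseteq> vec_space E" if "W \<in> D" for W
    using D that
    by (auto simp: irreducible_decomposition_def irreducible_submodule_def submodule_on_def)
  have "(\<Sum>e\<in>E. P e e) = of_nat (card I)"
  proof (rule trace_eq_card[where w = x and P = P, OF fin])
    show "finite I" using finD by (simp add: I_def)
    show "x W \<in> vec_space E" if "W \<in> I" for W using x(1)[OF that] that sub(2) by (auto simp: I_def)
    show "mat_act E P (x W) = x W" if "W \<in> I" for W using x that by auto
    show "c W = 0" if c: "(\<Sum>i\<in>I. vec_scale (c i) (x i)) = 0" "W \<in> I" for c W
    proof -
      define y where "y U = (if U \<in> I then vec_scale (c U) (x U) else 0)" for U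
      have "(\<Sum>U\<in>D. y U) = (\<Sum>U\<in>I. y U)"
        using finD by (intro sum.mono_neutral_right) (auto simp: I_def y_def)
      then have "(\<Sum>U\<in>D. y U) = 0" using c by (simp add: y_def)
      moreover have "\<forall>U\<in>D. y U \<in> U"
        by (simp add: y_def x(1) sub(1) edge_space.subspace_0 edge_space.subspace_scale)
      moreover have "W \<in> D" using c(2) by (simp add: I_def)
      ultimately have "y W = 0" using irreducible_decomposition_zero[OF D, of y W] by simp
      then have "vec_scale (c W) (x W) = 0" using c(2) by (simp only: y_def if_True)
      then show ?thesis using x(2)[OF c(2)] unfolding edge_space.scale_eq_0_iff by blast
    qed
    show "\<exists>c. mat_act E P (delta f) = (\<Sum>i\<in>I. vec_scale (c i) (x i))" if f: "f \<in> E" for f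
    proof -
      obtain w where w: "w \<in> (\<Pi>\<^sub>E W\<in>D. W)" "delta f = (\<Sum>W\<in>D. w W)"
        using D delta_in_vec_space[OF f] unfolding irreducible_decomposition_def by metis
      have wD: "w W \<in> W" if "W \<in> D" for W using w that by auto
      have "\<exists>c. mat_act E P (w W) = vec_scale c (x W)" if "W \<in> I" for W
        using x(4)[OF that] wD that by (auto simp: I_def)
      then obtain c where c: "\<And>W. W \<in> I \<Longrightarrow> mat_act E P (w W) = vec_scale (c W) (x W)"
        by metis
      have "mat_act E P (delta f) = (\<Sum>W\<in>D. mat_act E P (w W))" by (simp add: w(2) mat_act_sum)
      also have "\<dots> = (\<Sum>W\<in>I. mat_act E P (w W))"
        using finD zero wD by (intro sum.mono_neutral_right) (auto simp: I_def)
      also have "\<dots> = (\<Sum>W\<in>I. vec_scale (c W) (x W))" using c by simp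
      finally show ?thesis by blast
    qed
  qed
  then show ?thesis by (simp only: I_def)
qed

section \<open>Complete reducibility of the standard module of the adjacency algebra\<close>

lemma adj_algebra_adjoint:
  assumes "P \<in> adj_algebra E A B"
  shows "adjoint_mat P \<in> adj_algebra E A B"
  using assms
proof induction
  case one
  have "adjoint_mat (mat_one E) = mat_one E" by (auto simp: adjoint_mat_def mat_one_def fun_eq_iff)
  then show ?case by (simp add: adj_algebra.one)
next
  case genM
  have "adjoint_mat (share_mat E A) = share_mat E A"
    by (auto simp: adjoint_mat_def share_mat_def fun_eq_iff)
  then show ?case by (simp add: adj_algebra.genM)
next
  case genN
  have "adjoint_mat (share_mat E B) = share_mat E B"
    by (auto simp: adjoint_mat_def share_mat_def fun_eq_iff)
  then show ?case by (simp add: adj_algebra.genN)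
next
  case (add P Q)
  have "adjoint_mat (P + Q) = adjoint_mat P + adjoint_mat Q"
    by (auto simp: adjoint_mat_def fun_eq_iff)
  then show ?case using add by (simp only: adj_algebra.add)
next
  case (scale P c)
  have "adjoint_mat (mat_scale c P) = mat_scale (cnj c) (adjoint_mat P)"
    by (auto simp: adjoint_mat_def mat_scale_def fun_eq_iff)
  then show ?case using scale by (simp add: adj_algebra.scale)
next
  case (mult P Q)
  have "adjoint_mat (mat_mult E P Q) = mat_mult E (adjoint_mat Q) (adjoint_mat P)"
    by (auto simp: adjoint_mat_def mat_mult_def fun_eq_iff mult.commute)
  then show ?case using mult by (simp add: adj_algebra.mult)
qed

lemma adj_algebra_outside:
  assumes "P \<in> adj_algebra E A B" "e \<notin> E \<or> f \<notin> E"
  shows "P e f = 0"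
  using assms
  by (induction arbitrary: e f)
    (auto simp: mat_one_def share_mat_def mat_scale_def mat_mult_def intro!: sum.neutral)

lemma std_submodule: "submodule_on E (adj_algebra E A B) (vec_space E)"
  using vec_space_subspace adj_algebra_outside
  by (fastforce simp: submodule_on_def vec_space_def mat_act_def intro!: sum.neutral)

lemma irreducible_decomposition_exists:
  "finite E \<Longrightarrow> \<exists>D. irreducible_decomposition E (adj_algebra E A B) D"
  using module_decomposition_exists[OF _ adj_algebra_adjoint std_submodule]
    irreducible_decomposition_if by blast


section \<open>The scalar recurrence\<close>

text \<open>\<open>cheb t c n\<close> is \<open>\<surd>c\<^sup>n\<^sup>-\<^sup>1\<close> times the Chebyshev polynomial of the second kind of degree
  \<open>n - 1\<close> at \<open>t / 2\<surd>c\<close>.\<close>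

fun cheb :: "'a::comm_ring_1 \<Rightarrow> 'a \<Rightarrow> nat \<Rightarrow> 'a" where
  "cheb t c 0 = 0"
| "cheb t c (Suc 0) = 1"
| "cheb t c (Suc (Suc n)) = t * cheb t c (Suc n) - c * cheb t c n"

text \<open>\<open>F_poly\<close> obeys the recurrence of \<open>cheb\<close> with the starting
  values 1 and X + k, which determine the combination of two consecutive terms.\<close>

lemma poly_F_poly:
  "poly (map_poly of_int (F_poly k l n)) (t :: 'a::comm_ring_1) =
    cheb t (of_nat k * of_nat l) (Suc n) + of_nat k * cheb t (of_nat k * of_nat l) n"
proof -
  let ?ev = "\<lambda>p. poly (map_poly of_int p) t"
  have diff: "?ev (p - q) = ?ev p - ?ev q" for p q
    by (induction p q rule: poly_induct2) (simp_all add: map_poly_pCons ring_distribs diff_diff_eq)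
  have smult: "?ev (smult a p) = of_int a * ?ev p" for a p
    by (induction p) (simp_all add: map_poly_pCons algebra_simps)
  have shift: "?ev (pCons 0 p) = t * ?ev p" for p
    by (simp add: map_poly_pCons)
  show ?thesis
  proof (induction k l n rule: F_poly.induct)
    case (3 k l i)
    have "F_poly k l (Suc (Suc i)) =
        pCons 0 (F_poly k l (Suc i)) - smult (int k * int l) (F_poly k l i)"
      by simp
    then show ?case unfolding diff smult shift 3 by (simp add: diff smult shift 3 algebra_simps)
  qed (simp_all add: map_poly_pCons)
qed

text \<open>Summing the recurrence telescopes; t - c - 1 is minus the value at 1 of the
  characteristic polynomial \<open>x\<^sup>2 - t x + c\<close>.\<close>

lemma cheb_sum:
  "(t - c - 1) * (\<Sum>i<n. cheb t c (Suc i)) = cheb t c (Suc n) - 1 - c * cheb t c n"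
  by (induction n) (simp_all add: algebra_simps)

lemma cheb_sum_rev:
  "(t - c - 1) * (\<Sum>i<n. cheb t c (n - i)) = cheb t c (Suc n) - 1 - c * cheb t c n"
proof -
  have "(\<Sum>i<n. cheb t c (n - i)) = (\<Sum>i<n. cheb t c (Suc i))"
    by (rule sum.reindex_bij_witness[of _ "\<lambda>i. n - Suc i" "\<lambda>i. n - Suc i"])
      (auto simp del: cheb.simps simp: Suc_diff_Suc)
  then show ?thesis by (simp only: cheb_sum)
qed

text \<open>Variation of constants: \<open>cheb\<close> is the fundamental solution of the
  recurrence, and this convolution solves it with zero start and inhomogeneous term
  \<open>x\<close>, see \<open>cheb_conv_rec\<close>.\<close>

definition cheb_conv :: "'a::comm_ring_1 \<Rightarrow> 'a \<Rightarrow> (nat \<Rightarrow> 'a) \<Rightarrow> nat \<Rightarrow> 'a" where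
  "cheb_conv t c x n = (\<Sum>i<n. cheb t c (n - i) * x i)"

lemma cheb_conv_0 [simp]: "cheb_conv t c x 0 = 0"
  by (simp add: cheb_conv_def)

lemma cheb_conv_Suc_0 [simp]: "cheb_conv t c x (Suc 0) = x 0"
  by (simp add: cheb_conv_def)

lemma cheb_conv_rec:
  "cheb_conv t c x (Suc (Suc n)) = t * cheb_conv t c x (Suc n) - c * cheb_conv t c x n + x (Suc n)"
proof -
  have "(\<Sum>i<n. cheb t c (Suc (Suc n) - i) * x i) =
      (\<Sum>i<n. t * (cheb t c (Suc n - i) * x i) - c * (cheb t c (n - i) * x i))"
    by (intro sum.cong) (auto simp: Suc_diff_le algebra_simps)
  also have "\<dots> = t * (\<Sum>i<n. cheb t c (Suc n - i) * x i) - c * (\<Sum>i<n. cheb t c (n - i) * x i)"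
    by (simp add: sum_subtractf sum_distrib_left)
  finally show ?thesis by (simp add: cheb_conv_def Suc_diff_le algebra_simps)
qed

text \<open>If multiplication by \<open>X + k + l\<close> maps \<open>x i\<close> to \<open>y i\<close>, where the \<open>x i\<close> satisfy the recurrence
  of the \<open>F i\<close>, then \<open>cheb_conv\<close> divides \<open>x n\<close> by \<open>X - t\<close> with remainder \<open>F n\<close> at \<open>t\<close>.\<close>

lemma cheb_conv_division:
  assumes y0: "n > 0 \<Longrightarrow> y 0 = x 1 + l * x 0"
    and y: "\<And>i. Suc i < n \<Longrightarrow> y (Suc i) = x (Suc (Suc i)) + (k + l) * x (Suc i) + k * l * x i"
  shows "cheb_conv t (k * l) y n = (t + k + l) * cheb_conv t (k * l) x n + x n -
    (cheb t (k * l) (Suc n) + k * cheb t (k * l) n) * x 0"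
  using assms
proof (induction n rule: induct_nat_012)
  case 0 then show ?case by simp
next
  case 1 then show ?case by (simp add: algebra_simps)
next
  case (ge2 n)
  have 1: "cheb_conv t (k * l) y n = (t + k + l) * cheb_conv t (k * l) x n + x n -
      (cheb t (k * l) (Suc n) + k * cheb t (k * l) n) * x 0"
    using ge2.prems by (intro ge2.IH(1)) simp_all
  have 2: "cheb_conv t (k * l) y (Suc n) =
      (t + k + l) * cheb_conv t (k * l) x (Suc n) + x (Suc n) -
      (cheb t (k * l) (Suc (Suc n)) + k * cheb t (k * l) (Suc n)) * x 0"
    using ge2.prems by (intro ge2.IH(2)) simp_all
  have 3: "y (Suc n) = x (Suc (Suc n)) + (k + l) * x (Suc n) + k * l * x n"
    using ge2.prems by simp
  show ?case unfolding cheb_conv_rec 1 2 3 by (simp add: algebra_simps)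
qed

text \<open>The quotient of \<open>F n\<close> minus \<open>F n\<close> at \<open>t\<close> by \<open>X - t\<close>, evaluated at \<open>t\<close>.\<close>

definition F_deriv :: "'a::comm_ring_1 \<Rightarrow> 'a \<Rightarrow> 'a \<Rightarrow> nat \<Rightarrow> 'a" where
  "F_deriv t c k = cheb_conv t c (\<lambda>i. cheb t c (Suc i) + k * cheb t c i)"

lemma F_deriv_rec:
  "F_deriv t c k (Suc (Suc n)) =
    t * F_deriv t c k (Suc n) - c * F_deriv t c k n + cheb t c (Suc (Suc n)) + k * cheb t c (Suc n)"
  unfolding F_deriv_def cheb_conv_rec by (simp add: algebra_simps)

text \<open>\<open>F_deriv\<close> is the derivative of F_n at t. This is the Chebyshev identity
  that multiplies a derivative by the discriminant of the characteristic polynomial and expresses it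
  through two consecutive terms; the induction runs along the differentiated recurrence.\<close>

lemma F_deriv_closed:
  "(t\<^sup>2 - 4 * c) * F_deriv t c k n =
    of_nat n * t * cheb t c (Suc n) - 2 * c * of_nat (Suc n) * cheb t c n +
    k * (2 * of_nat n * cheb t c (Suc n) - of_nat (Suc n) * t * cheb t c n)"
proof (induction n rule: induct_nat_012)
  case 0 then show ?case by (simp add: F_deriv_def)
next
  case 1 then show ?case by (simp add: F_deriv_def power2_eq_square algebra_simps)
next
  case (ge2 n)
  have "(t\<^sup>2 - 4 * c) * F_deriv t c k (Suc (Suc n)) =
     t * ((t\<^sup>2 - 4 * c) * F_deriv t c k (Suc n)) - c * ((t\<^sup>2 - 4 * c) * F_deriv t c k n) +
     (t\<^sup>2 - 4 * c) * (cheb t c (Suc (Suc n)) + k * cheb t c (Suc n))"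
    unfolding F_deriv_rec by (simp add: algebra_simps)
  then show ?case unfolding ge2 by (simp add: algebra_simps power2_eq_square)
qed

text \<open>At a zero of F_r one Chebyshev value can be eliminated; the second factor of the
  denominator in the multiplicity formula appears here.\<close>

lemma F_deriv_at_root:
  assumes "cheb t (k * l) (Suc r) + k * cheb t (k * l) r = 0"
  shows "(t\<^sup>2 - 4 * k * l) * F_deriv t (k * l) k r =
    - k * cheb t (k * l) r * ((2 * of_nat r + 1) * (t + k + l) + l - k)"
proof -
  have *: "cheb t (k * l) (Suc r) = - k * cheb t (k * l) r"
    using assms by (simp add: eq_neg_iff_add_eq_0)
  show ?thesis
    using F_deriv_closed[of t "k * l" k r] unfolding * by (simp add: algebra_simps)
qed

text \<open>At -k-l the characteristic polynomial is (x + k)(x + l), and F_n is a purely geometric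
  solution. For l > 0 it follows that -k-l is no zero of F_n, which later gives
  \<open>\<theta>_nonzero\<close>.\<close>

lemma F_at_minus_sum:
  "cheb (- k - l) (k * l) (Suc n) + k * cheb (- k - l) (k * l) n = (- l) ^ n"
  for k l :: "'a::comm_ring_1"
proof (induction n rule: induct_nat_012)
  case (ge2 n)
  let ?u = "cheb (- k - l) (k * l)"
  have "?u (Suc (Suc (Suc n))) + k * ?u (Suc (Suc n)) =
      (- k - l) * (?u (Suc (Suc n)) + k * ?u (Suc n)) - k * l * (?u (Suc n) + k * ?u n)"
    by (simp add: algebra_simps)
  then show ?case unfolding ge2 by (simp add: algebra_simps)
qed simp_all


section \<open>Distances in bipartite graphs of large girth\<close>

definition nbrs :: "'v set set \<Rightarrow> 'v \<Rightarrow> 'v set" where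
  "nbrs E u = {w. {u, w} \<in> E}"

definition edge_end :: "'v set \<Rightarrow> 'v set \<Rightarrow> 'v" where
  "edge_end C e = the_elem (e \<inter> C)"

locale bipartite_graph =
  fixes V A B :: "'v set" and E :: "'v set set"
  assumes simple: "simple_graph V E"
    and conn: "connected_graph V E"
    and bip: "bipartition V E A B"
begin

lemma finite_V: "finite V" and finite_E: "finite E"
proof -
  show "finite V" using simple by (simp add: simple_graph_def)
  moreover have "E \<subseteq> Pow V" using simple by (auto simp: simple_graph_def)
  ultimately show "finite E" by (simp add: finite_subset)
qed

lemma edge_in_V: "{u, w} \<in> E \<Longrightarrow> u \<in> V" "{u, w} \<in> E \<Longrightarrow> w \<in> V"
  using simple by (auto simp: simple_graph_def)

lemma finite_nbrs: "finite (nbrs E u)"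
  using finite_V by (rule finite_subset[rotated]) (auto simp: nbrs_def edge_in_V)

lemma V_eq: "A \<union> B = V" and A_B_disjoint: "A \<inter> B = {}"
  using bip by (auto simp: bipartition_def)

lemma edge_classes: "{u, w} \<in> E \<Longrightarrow> w \<in> A \<longleftrightarrow> u \<notin> A"
  using bip by (fastforce simp: bipartition_def doubleton_eq_iff)

lemma edge_ends:
  assumes "e \<in> E"
  shows "edge_end A e \<in> A" "edge_end B e \<in> B" "e = {edge_end A e, edge_end B e}"
    "e \<inter> A = {edge_end A e}" "e \<inter> B = {edge_end B e}"
proof -
  obtain a b where ab: "a \<in> A" "b \<in> B" "e = {a, b}"
    using bip assms by (auto simp: bipartition_def)
  then have inter: "e \<inter> A = {a}" "e \<inter> B = {b}" using A_B_disjoint by auto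
  then have ends: "edge_end A e = a" "edge_end B e = b" by (simp_all add: edge_end_def)
  show "edge_end A e \<in> A" "edge_end B e \<in> B" "e = {edge_end A e, edge_end B e}"
    "e \<inter> A = {edge_end A e}" "e \<inter> B = {edge_end B e}"
    unfolding ends by fact+
qed

lemma edge_end_doubleton:
  assumes "{a, b} \<in> E" "a \<in> A"
  shows "edge_end A {a, b} = a" "edge_end B {a, b} = b"
proof -
  have "b \<in> B" using edge_classes[OF assms(1)] edge_in_V[OF assms(1)] V_eq assms(2) by auto
  then have "{a, b} \<inter> A = {a}" "{a, b} \<inter> B = {b}" using A_B_disjoint assms(2) by auto
  then show "edge_end A {a, b} = a" "edge_end B {a, b} = b" by (simp_all add: edge_end_def)
qed

lemma bij_betw_nbrs:
  assumes "a \<in> A"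
  shows "bij_betw (edge_end B) {g\<in>E. edge_end A g = a} (nbrs E a)"
proof (rule bij_betwI[where g = "\<lambda>b. {a, b}"])
  have *: "{a, edge_end B g} = g" if "g \<in> {g\<in>E. edge_end A g = a}" for g
    using edge_ends(3)[of g] that by simp
  show "edge_end B \<in> {g\<in>E. edge_end A g = a} \<rightarrow> nbrs E a"
    using * by (auto simp: nbrs_def)
  show "(\<lambda>b. {a, b}) \<in> nbrs E a \<rightarrow> {g\<in>E. edge_end A g = a}"
    using assms edge_end_doubleton by (auto simp: nbrs_def)
  show "{a, edge_end B g} = g" if "g \<in> {g\<in>E. edge_end A g = a}" for g
    using that by (rule *)
  show "edge_end B {a, b} = b" if "b \<in> nbrs E a" for b
    using that assms edge_end_doubleton by (auto simp: nbrs_def)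
qed

lemma card_nbrs: "card (nbrs E u) = degree_in E u"
proof -
  have "bij_betw (\<lambda>w. {u, w}) (nbrs E u) {e\<in>E. u \<in> e}"
    unfolding bij_betw_def
  proof
    show "inj_on (\<lambda>w. {u, w}) (nbrs E u)" by (auto simp: inj_on_def doubleton_eq_iff)
    have "\<exists>w. e = {u, w}" if "e \<in> E" "u \<in> e" for e
      using edge_ends(3)[OF that(1)] that(2) by (metis insert_iff insert_commute singletonD)
    then show "(\<lambda>w. {u, w}) ` nbrs E u = {e\<in>E. u \<in> e}" by (fastforce simp: nbrs_def)
  qed
  then show ?thesis by (simp add: degree_in_def bij_betw_same_card)
qed

lemma adj_sym: "(u, v) \<in> adj_rel E ^^ n \<Longrightarrow> (v, u) \<in> adj_rel E ^^ n"
proof (induction n arbitrary: v)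
  case (Suc n)
  then obtain w where "(u, w) \<in> adj_rel E ^^ n" "(w, v) \<in> adj_rel E" by auto
  then have "(w, u) \<in> adj_rel E ^^ n" "(v, w) \<in> adj_rel E"
    using Suc.IH by (auto simp: adj_rel_def insert_commute)
  then show ?case by (metis relpow_Suc_I2)
qed simp

lemma adj_parity: "(u, v) \<in> adj_rel E ^^ n \<Longrightarrow> v \<in> A \<longleftrightarrow> (u \<in> A \<longleftrightarrow> even n)"
proof (induction n arbitrary: v)
  case (Suc n)
  then obtain w where "(u, w) \<in> adj_rel E ^^ n" "{w, v} \<in> E" by (auto simp: adj_rel_def)
  then show ?case using Suc.IH edge_classes by auto
qed auto

lemma gdist_le: "(u, v) \<in> adj_rel E ^^ n \<Longrightarrow> gdist E u v \<le> n"
  unfolding gdist_def by (rule Least_le)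

lemma gdist_walk:
  assumes "u \<in> V" "v \<in> V"
  shows "(u, v) \<in> adj_rel E ^^ gdist E u v"
proof -
  have "\<exists>n. (u, v) \<in> adj_rel E ^^ n"
    using conn assms by (auto simp: connected_graph_def rtrancl_imp_relpow)
  then show ?thesis unfolding gdist_def by (rule LeastI_ex)
qed

lemma gdist_self [simp]: "gdist E u u = 0"
  using gdist_le[of u u 0] by simp

lemma gdist_eq_0_iff: "u \<in> V \<Longrightarrow> v \<in> V \<Longrightarrow> gdist E u v = 0 \<longleftrightarrow> u = v"
  using gdist_walk[of u v] by auto

lemma gdist_commute: "u \<in> V \<Longrightarrow> v \<in> V \<Longrightarrow> gdist E u v = gdist E v u"
  by (meson adj_sym antisym gdist_le gdist_walk)

lemma gdist_edge: "{u, w} \<in> E \<Longrightarrow> v \<in> V \<Longrightarrow> gdist E u v \<le> Suc (gdist E w v)"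
  by (rule gdist_le, rule relpow_Suc_I2[OF _ gdist_walk]) (auto simp: adj_rel_def edge_in_V)

lemma gdist_edge': "{u, w} \<in> E \<Longrightarrow> v \<in> V \<Longrightarrow> gdist E w v \<le> Suc (gdist E u v)"
  using gdist_edge[of w u v] by (simp add: insert_commute)

lemma gdist_parity: "u \<in> V \<Longrightarrow> v \<in> V \<Longrightarrow> even (gdist E u v) \<longleftrightarrow> (u \<in> A \<longleftrightarrow> v \<in> A)"
  using adj_parity[OF gdist_walk] by blast

lemma gdist_pred:
  assumes "u \<in> V" "v \<in> V" "u \<noteq> v"
  shows "\<exists>w. {u, w} \<in> E \<and> Suc (gdist E w v) = gdist E u v"
proof -
  obtain n where n: "gdist E u v = Suc n"
    using gdist_eq_0_iff assms by (metis not0_implies_Suc)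
  then have "(u, v) \<in> adj_rel E ^^ Suc n" using gdist_walk assms by metis
  then obtain w where w: "{u, w} \<in> E" "(w, v) \<in> adj_rel E ^^ n"
    by (metis adj_rel_def case_prodD mem_Collect_eq relpow_Suc_D2)
  have "gdist E w v \<le> n" using w by (intro gdist_le)
  moreover have "Suc n \<le> Suc (gdist E w v)" using gdist_edge[OF w(1) assms(2)] n by simp
  ultimately show ?thesis using w(1) n by auto
qed

text \<open>Two different predecessors, continued by the same choice of predecessors until they
  merge, would form a cycle of length at most twice the distance.\<close>

lemma unique_pred:
  assumes girth: "enat (2 * gdist E u v) < girth E" and uv: "u \<in> V" "v \<in> V"
    and w1: "{u, w1} \<in> E" "Suc (gdist E w1 v) = gdist E u v"
    and w2: "{u, w2} \<in> E" "Suc (gdist E w2 v) = gdist E u v"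
  shows "w1 = w2"
proof (rule ccontr)
  assume neq: "w1 \<noteq> w2"
  define n where "n = gdist E w1 v"
  obtain p where p: "\<And>x. x \<in> V \<Longrightarrow> x \<noteq> v \<Longrightarrow> {x, p x} \<in> E \<and> Suc (gdist E (p x) v) = gdist E x v"
    using gdist_pred[OF _ uv(2)] by metis
  define P where "P w i = (p ^^ i) w" for w i
  have P: "P w i \<in> V \<and> gdist E (P w i) v = n - i"
    if "w \<in> V" "gdist E w v = n" "i \<le> n" for w i
    using that(3)
  proof (induction i)
    case (Suc i)
    then have "P w i \<in> V" "gdist E (P w i) v = n - i" by auto
    moreover from this Suc.prems have "P w i \<noteq> v" by auto
    ultimately show ?case using p[of "P w i"] edge_in_V by (auto simp: P_def)
  qed (use that in \<open>simp add: P_def\<close>)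
  have PE: "{P w i, P w (Suc i)} \<in> E" if "w \<in> V" "gdist E w v = n" "i < n" for w i
  proof -
    have "P w i \<in> V" "P w i \<noteq> v" using P[OF that(1,2), of i] that(3) by auto
    then show ?thesis using p by (auto simp: P_def)
  qed
  have w: "w1 \<in> V" "w2 \<in> V" "gdist E w1 v = n" "gdist E w2 v = n"
    using w1 w2 edge_in_V by (auto simp: n_def)
  note P1 = P[OF w(1,3)] and P2 = P[OF w(2,4)] and E1 = PE[OF w(1,3)] and E2 = PE[OF w(2,4)]
  have "P w1 n = P w2 n" using P1[of n] P2[of n] uv gdist_eq_0_iff by auto
  then have ex: "\<exists>m. P w1 m = P w2 m" by blast
  define m where "m = (LEAST m. P w1 m = P w2 m)"
  have m: "P w1 m = P w2 m" unfolding m_def using ex by (rule LeastI_ex)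
  have m_le: "m \<le> n" unfolding m_def using \<open>P w1 n = P w2 n\<close> by (rule Least_le)
  have before: "P w1 i \<noteq> P w2 i" if "i < m" for i
    using that not_less_Least unfolding m_def by blast
  have "m \<noteq> 0" using m neq by (auto simp: P_def intro!: gr0I)
  \<comment> \<open>Out along the first path to the merging point and back along the second without
    repeating that point, hence of length \<open>2 * m + 2\<close>, at most twice the distance from
    \<open>u\<close> to \<open>v\<close>.\<close>
  define c where "c = u # map (P w1) [0..<Suc m] @ rev (map (P w2) [0..<m])"
  \<comment> \<open>The distance of \<open>P w i\<close> to \<open>v\<close> is
    \<open>n - i\<close>, so equal vertices have equal indices, also across the two paths.\<close>
  have dist1: "i = j" if "P w1 i = P w1 j" "i \<le> m" "j \<le> m" for i j
    using P1[of i] P1[of j] m_le that by (metis diff_diff_cancel order_trans)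
  have dist2: "i = j" if "P w2 i = P w2 j" "i \<le> m" "j \<le> m" for i j
    using P2[of i] P2[of j] m_le that by (metis diff_diff_cancel order_trans)
  have dist12: False if "P w1 i = P w2 j" "i \<le> m" "j < m" for i j
  proof (cases "i = j")
    case True then show ?thesis using before that by simp
  next
    case False
    then show ?thesis using P1[of i] P2[of j] m_le that
      by (metis diff_diff_cancel order_trans less_imp_le)
  qed
  have u: "gdist E u v = Suc n" using w1(2) by (simp add: n_def)
  have distu: False if "u = P w i" "i \<le> m" "w \<in> {w1, w2}" for w i
    using P1[of i] P2[of i] that m_le u by auto
  have "distinct (map (P w1) [0..<Suc m])" "distinct (map (P w2) [0..<m])"
    using dist1 dist2 by (auto simp: distinct_map inj_on_def less_Suc_eq_le simp del: upt_Suc)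
  moreover have "set (map (P w1) [0..<Suc m]) \<inter> set (map (P w2) [0..<m]) = {}"
    using dist12 by (auto simp: less_Suc_eq_le simp del: upt_Suc)
  moreover have "u \<notin> set (map (P w1) [0..<Suc m] @ rev (map (P w2) [0..<m]))"
  proof
    assume "u \<in> set (map (P w1) [0..<Suc m] @ rev (map (P w2) [0..<m]))"
    then have "u \<in> P w1 ` {..m} \<union> P w2 ` {..m}"
      by (auto simp: less_Suc_eq_le simp del: upt_Suc)
    then obtain i where "i \<le> m" "u = P w1 i \<or> u = P w2 i" by blast
    then show False using distu by blast
  qed
  ultimately have "distinct c"
    unfolding c_def by (simp only: distinct.simps distinct_append distinct_rev set_rev) simp
  moreover have "length c = 2 * m + 2" by (simp add: c_def)
  moreover have "successively (\<lambda>x y. {x, y} \<in> E) c"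
  proof -
    have s1: "successively (\<lambda>x y. {x, y} \<in> E) (map (P w1) [0..<Suc m])"
      using E1 m_le by (auto simp: successively_conv_nth simp del: upt_Suc)
    have s2: "successively (\<lambda>x y. {x, y} \<in> E) (rev (map (P w2) [0..<m]))"
      unfolding successively_rev
      using E2 m_le by (auto simp: successively_conv_nth insert_commute)
    have "{P w1 m, P w2 (m - 1)} \<in> E"
      using E2[of "m - 1"] m m_le \<open>m \<noteq> 0\<close> by (simp add: insert_commute)
    then have "successively (\<lambda>x y. {x, y} \<in> E)
        (map (P w1) [0..<Suc m] @ rev (map (P w2) [0..<m]))"
      using s1 s2 \<open>m \<noteq> 0\<close>
      by (auto simp: successively_append_iff hd_rev last_map simp del: upt_Suc map_append)
    moreover have "hd (map (P w1) [0..<Suc m] @ rev (map (P w2) [0..<m])) = w1"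
      by (simp add: hd_append hd_map P_def del: upt_Suc)
    ultimately show ?thesis using w1(1) by (auto simp: c_def successively_Cons)
  qed
  moreover have "{last c, hd c} \<in> E"
    using w2(1) \<open>m \<noteq> 0\<close> by (simp add: c_def last_rev hd_map P_def insert_commute)
  ultimately have "is_cycle E c"
    using \<open>m \<noteq> 0\<close> by (simp add: is_cycle_def successively_conv_nth)
  then have "girth E \<le> enat (length c)" unfolding girth_def by (intro INF_lower) simp
  also have "\<dots> \<le> enat (2 * gdist E u v)"
    using \<open>length c = 2 * m + 2\<close> m_le w1(2) by (simp add: n_def)
  finally show False using girth by simp
qed

text \<open>Parity excludes distance exactly \<open>j\<close>. Below \<open>j\<close> all neighbours
  count, at \<open>Suc j\<close> only the unique predecessor, beyond that none. The two indicators
  are shaped to be entries of two consecutive ball matrices.\<close>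

lemma card_nbrs_within:
  assumes uv: "u \<in> V" "v \<in> V" and odd: "odd (gdist E u v + j)"
    and girth: "enat (2 * Suc j) < girth E" and deg: "card (nbrs E u) = Suc q"
  shows "card {w\<in>nbrs E u. gdist E w v \<le> j} =
    of_bool (gdist E u v \<le> Suc j) + q * of_bool (Suc (gdist E u v) \<le> j)"
proof -
  have "gdist E u v \<noteq> j" using odd by auto
  then have "Suc (gdist E u v) \<le> j \<or> gdist E u v = Suc j \<or> gdist E u v > Suc j" by linarith
  then consider "Suc (gdist E u v) \<le> j" | "gdist E u v = Suc j" | "gdist E u v > Suc j"
    by blast
  then show ?thesis
  proof cases
    case 1
    then have "{w\<in>nbrs E u. gdist E w v \<le> j} = nbrs E u"
      using gdist_edge' uv by (fastforce simp: nbrs_def)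
    then show ?thesis using 1 deg by simp
  next
    case 2
    then have "u \<noteq> v" by auto
    then obtain w where w: "{u, w} \<in> E" "Suc (gdist E w v) = gdist E u v"
      using gdist_pred uv by blast
    have "x = w" if x: "{u, x} \<in> E" "gdist E x v \<le> j" for x
    proof (rule unique_pred[OF _ uv x(1) _ w])
      show "enat (2 * gdist E u v) < girth E" using girth 2 by simp
      show "Suc (gdist E x v) = gdist E u v" using gdist_edge[OF x(1) uv(2)] x(2) 2 by simp
    qed
    moreover have "w \<in> nbrs E u" "gdist E w v \<le> j" using w 2 by (simp_all add: nbrs_def)
    ultimately have "{w\<in>nbrs E u. gdist E w v \<le> j} = {w}" unfolding nbrs_def by blast
    then show ?thesis using 2 by simp
  next
    case 3
    then have "{w\<in>nbrs E u. gdist E w v \<le> j} = {}"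
      using gdist_edge uv by (fastforce simp: nbrs_def)
    then show ?thesis using 3 by (simp only:) simp
  qed
qed

lemma share_mat_plus_one:
  "(share_mat E A + mat_one E) e f = of_bool (e \<in> E \<and> f \<in> E \<and> edge_end A e = edge_end A f)"
  "(share_mat E B + mat_one E) e f = of_bool (e \<in> E \<and> f \<in> E \<and> edge_end B e = edge_end B f)"
proof -
  have inter: "e \<inter> f \<inter> C = (e \<inter> C) \<inter> (f \<inter> C)" for C by blast
  have A: "e \<inter> f \<inter> A \<noteq> {} \<longleftrightarrow> edge_end A e = edge_end A f"
    and B: "e \<inter> f \<inter> B \<noteq> {} \<longleftrightarrow> edge_end B e = edge_end B f" if "e \<in> E" "f \<in> E"
    unfolding inter edge_ends(4,5)[OF that(1)] edge_ends(4,5)[OF that(2)] by auto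
  show "(share_mat E A + mat_one E) e f = of_bool (e \<in> E \<and> f \<in> E \<and> edge_end A e = edge_end A f)"
    using A by (auto simp: share_mat_def mat_one_def)
  show "(share_mat E B + mat_one E) e f = of_bool (e \<in> E \<and> f \<in> E \<and> edge_end B e = edge_end B f)"
    using B by (auto simp: share_mat_def mat_one_def)
qed

end

lemma bipartite_graph_swap: "bipartite_graph V A B E \<Longrightarrow> bipartite_graph V B A E"
  unfolding bipartite_graph_def bipartition_def by (metis Int_commute Un_commute insert_commute)


section \<open>An eigenmatrix of the adjacency algebra\<close>

context bipartite_graph
begin

text \<open>Edges with a given end in \<open>A\<close> correspond to the neighbours of that end, so
  a product with the matrix of common ends in \<open>A\<close> counts neighbours. The interpretation
  with swapped classes gives the same for \<open>B\<close>.\<close>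

lemma sum_common_end:
  assumes "e \<in> E"
  shows "(\<Sum>g\<in>E. of_bool (edge_end A e = edge_end A g) * of_bool (Q (edge_end B g))) =
    (of_nat (card {w\<in>nbrs E (edge_end A e). Q w}) :: complex)"
proof -
  let ?G = "{g\<in>E. edge_end A g = edge_end A e}"
  have "(\<Sum>g\<in>E. of_bool (edge_end A e = edge_end A g) * of_bool (Q (edge_end B g))) =
      (\<Sum>g\<in>?G. of_bool (Q (edge_end B g)) :: complex)"
    using finite_E by (intro sum.mono_neutral_cong_right) auto
  also have "\<dots> = (\<Sum>w\<in>nbrs E (edge_end A e). of_bool (Q w))"
    by (rule sum.reindex_bij_betw[OF bij_betw_nbrs[OF edge_ends(1)[OF assms]]])
  also have "\<dots> = of_nat (card {w\<in>nbrs E (edge_end A e). Q w})"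
    using finite_nbrs by (simp add: Int_def)
  finally show ?thesis .
qed

end

section \<open>Ball matrices and their recurrence\<close>

locale girth_biregular = bipartite_graph +
  fixes r k l :: nat
  assumes r_pos: "r > 0"
    and girth_gt: "enat (4 * r) < girth E"
    and deg_A: "\<And>a. a \<in> A \<Longrightarrow> card (nbrs E a) = Suc k"
    and deg_B: "\<And>b. b \<in> B \<Longrightarrow> card (nbrs E b) = Suc l"
    and dist_B: "\<And>u v. u \<in> B \<Longrightarrow> v \<in> B \<Longrightarrow> gdist E u v \<le> 2 * r"
begin

abbreviation "mA \<equiv> share_mat E A + mat_one E"
abbreviation "mB \<equiv> share_mat E B + mat_one E"

definition ball_BB :: "nat \<Rightarrow> 'a set matrix_on" where
  "ball_BB i = (\<lambda>e f. of_bool (e \<in> E \<and> f \<in> E \<and> gdist E (edge_end B e) (edge_end B f) \<le> 2 * i))"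

text \<open>The bound 2i - 1 is written with \<open>Suc\<close> on the left, so that index 0 gives
  the zero matrix at once.\<close>

definition ball_AB :: "nat \<Rightarrow> 'a set matrix_on" where
  "ball_AB i =
    (\<lambda>e f. of_bool (e \<in> E \<and> f \<in> E \<and> Suc (gdist E (edge_end A e) (edge_end B f)) \<le> 2 * i))"

lemma ends_in_V: "e \<in> E \<Longrightarrow> edge_end A e \<in> V" "e \<in> E \<Longrightarrow> edge_end B e \<in> V"
  using edge_ends V_eq by blast+

lemma swap: "bipartite_graph V B A E"
  by (rule bipartite_graph_swap) unfold_locales

lemma mB_apply: "mB e f = of_bool (e \<in> E \<and> f \<in> E \<and> edge_end B e = edge_end B f)"
  by (rule share_mat_plus_one)

lemma mA_apply: "mA e f = of_bool (e \<in> E \<and> f \<in> E \<and> edge_end A e = edge_end A f)"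
  by (rule share_mat_plus_one)

lemma ball_BB_0: "ball_BB 0 = mB"
  using gdist_eq_0_iff ends_in_V unfolding fun_eq_iff mB_apply by (auto simp: ball_BB_def)

lemma ball_AB_0: "ball_AB 0 = 0"
  by (auto simp: ball_AB_def fun_eq_iff)

lemma ball_BB_r: "ball_BB r e f = of_bool (e \<in> E \<and> f \<in> E)"
  using dist_B edge_ends(2) by (auto simp: ball_BB_def)

lemma mA_ball_BB:
  assumes "i < r"
  shows "mat_mult E mA (ball_BB i) = ball_AB (Suc i) + mat_scale (of_nat k) (ball_AB i)"
proof (intro ext)
  fix e f
  show "mat_mult E mA (ball_BB i) e f = (ball_AB (Suc i) + mat_scale (of_nat k) (ball_AB i)) e f"
  proof (cases "e \<in> E \<and> f \<in> E")
    case True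
    let ?d = "gdist E (edge_end A e) (edge_end B f)"
    have "odd ?d"
      using gdist_parity[of "edge_end A e" "edge_end B f"] edge_ends A_B_disjoint ends_in_V True
      by blast
    have "2 * Suc (2 * i) \<le> 4 * r" using assms by simp
    then have girth: "enat (2 * Suc (2 * i)) < girth E"
      using girth_gt by (metis enat_ord_simps(1) order_le_less_trans)
    have "mat_mult E mA (ball_BB i) e f =
        (\<Sum>g\<in>E. of_bool (edge_end A e = edge_end A g) *
          of_bool (gdist E (edge_end B g) (edge_end B f) \<le> 2 * i))"
      unfolding mat_mult_def mA_apply ball_BB_def using True by (intro sum.cong) auto
    also have "\<dots> = of_nat (card {w\<in>nbrs E (edge_end A e). gdist E w (edge_end B f) \<le> 2 * i})"
      using True by (intro sum_common_end[where Q = "\<lambda>w. gdist E w (edge_end B f) \<le> 2 * i"]) simp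
    also have "card {w\<in>nbrs E (edge_end A e). gdist E w (edge_end B f) \<le> 2 * i} =
        of_bool (?d \<le> Suc (2 * i)) + k * of_bool (Suc ?d \<le> 2 * i)"
      using True \<open>odd ?d\<close> girth by (intro card_nbrs_within deg_A) (auto simp: ends_in_V edge_ends)
    also have "of_nat \<dots> = (ball_AB (Suc i) + mat_scale (of_nat k) (ball_AB i)) e f"
      using True by (simp add: ball_AB_def mat_scale_def)
    finally show ?thesis .
  next
    case False
    then show ?thesis
      unfolding mat_mult_def mA_apply by (auto simp: ball_AB_def mat_scale_def ball_BB_def)
  qed
qed

lemma mB_ball_AB:
  assumes "i < r"
  shows "mat_mult E mB (ball_AB (Suc i)) = ball_BB (Suc i) + mat_scale (of_nat l) (ball_BB i)"
proof (intro ext)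
  fix e f
  interpret swap: bipartite_graph V B A E by (rule swap)
  show "mat_mult E mB (ball_AB (Suc i)) e f =
    (ball_BB (Suc i) + mat_scale (of_nat l) (ball_BB i)) e f"
  proof (cases "e \<in> E \<and> f \<in> E")
    case True
    let ?d = "gdist E (edge_end B e) (edge_end B f)"
    have "even ?d"
      using gdist_parity[of "edge_end B e" "edge_end B f"] edge_ends A_B_disjoint ends_in_V True
      by blast
    \<comment> \<open>Equality holds for i = r - 1: this is where geodesics of length 2r have to be
      unique.\<close>
    have "2 * Suc (Suc (2 * i)) \<le> 4 * r" using assms by simp
    then have girth: "enat (2 * Suc (Suc (2 * i))) < girth E"
      using girth_gt by (metis enat_ord_simps(1) order_le_less_trans)
    have "mat_mult E mB (ball_AB (Suc i)) e f =
        (\<Sum>g\<in>E. of_bool (edge_end B e = edge_end B g) *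
          of_bool (gdist E (edge_end A g) (edge_end B f) \<le> Suc (2 * i)))"
      unfolding mat_mult_def mB_apply ball_AB_def using True by (intro sum.cong) auto
    also have "\<dots> =
        of_nat (card {w\<in>nbrs E (edge_end B e). gdist E w (edge_end B f) \<le> Suc (2 * i)})"
      using True
      by (intro swap.sum_common_end[where Q = "\<lambda>w. gdist E w (edge_end B f) \<le> Suc (2 * i)"]) simp
    also have "card {w\<in>nbrs E (edge_end B e). gdist E w (edge_end B f) \<le> Suc (2 * i)} =
        of_bool (?d \<le> Suc (Suc (2 * i))) + l * of_bool (Suc ?d \<le> Suc (2 * i))"
      using True \<open>even ?d\<close> girth by (intro card_nbrs_within deg_B) (auto simp: ends_in_V edge_ends)
    also have "of_nat \<dots> = (ball_BB (Suc i) + mat_scale (of_nat l) (ball_BB i)) e f"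
      using True by (simp add: ball_BB_def mat_scale_def)
    finally show ?thesis .
  next
    case False
    then show ?thesis
      unfolding mat_mult_def mB_apply by (auto simp: ball_AB_def mat_scale_def ball_BB_def)
  qed
qed

lemma mB_ball_BB: "mat_mult E mB (ball_BB i) = mat_scale (of_nat (Suc l)) (ball_BB i)"
proof (intro ext)
  fix e f
  interpret swap: bipartite_graph V B A E by (rule swap)
  show "mat_mult E mB (ball_BB i) e f = mat_scale (of_nat (Suc l)) (ball_BB i) e f"
  proof (cases "e \<in> E \<and> f \<in> E")
    case True
    have "mat_mult E mB (ball_BB i) e f =
        (\<Sum>g\<in>E. of_bool (edge_end B e = edge_end B g) * of_bool True) * ball_BB i e f"
      unfolding mat_mult_def mB_apply ball_BB_def sum_distrib_right
      using True by (intro sum.cong) auto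
    also have "\<dots> = of_nat (card {w\<in>nbrs E (edge_end B e). True}) * ball_BB i e f"
      using True swap.sum_common_end[of e "\<lambda>_. True"] by (simp only:)
    finally show ?thesis using True deg_B edge_ends(2) by (simp add: mat_scale_def)
  next
    case False
    then show ?thesis
      unfolding mat_mult_def mB_apply by (auto simp: mat_scale_def ball_BB_def)
  qed
qed

lemma mA_mA: "mat_mult E mA mA = mat_scale (of_nat (Suc k)) mA"
proof (intro ext)
  fix e f
  show "mat_mult E mA mA e f = mat_scale (of_nat (Suc k)) mA e f"
  proof (cases "e \<in> E \<and> f \<in> E")
    case True
    have "mat_mult E mA mA e f =
        (\<Sum>g\<in>E. of_bool (edge_end A e = edge_end A g) * of_bool True) * mA e f"
      unfolding mat_mult_def mA_apply sum_distrib_right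
      using True by (intro sum.cong) auto
    also have "\<dots> = of_nat (card {w\<in>nbrs E (edge_end A e). True}) * mA e f"
      using True sum_common_end[of e "\<lambda>_. True"] by (simp only:)
    finally show ?thesis using True deg_A edge_ends(1) by (simp add: mat_scale_def)
  next
    case False
    then show ?thesis
      unfolding mat_mult_def mA_apply by (auto simp: mat_scale_def)
  qed
qed

text \<open>This closes the recurrence: \<open>ball_BB r\<close> is the all-ones matrix and hence an
  eigenmatrix of \<open>mA\<close> as well as of \<open>mB\<close>.\<close>

lemma mA_ball_BB_r: "mat_mult E mA (ball_BB r) = mat_scale (of_nat (Suc k)) (ball_BB r)"
proof (intro ext)
  fix e f
  show "mat_mult E mA (ball_BB r) e f = mat_scale (of_nat (Suc k)) (ball_BB r) e f"
  proof (cases "e \<in> E \<and> f \<in> E")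
    case True
    have "mat_mult E mA (ball_BB r) e f =
        (\<Sum>g\<in>E. of_bool (edge_end A e = edge_end A g) * of_bool True)"
      unfolding mat_mult_def mA_apply ball_BB_r using True by (intro sum.cong) auto
    also have "\<dots> = of_nat (card {w\<in>nbrs E (edge_end A e). True})"
      using True sum_common_end[of e "\<lambda>_. True"] by (simp only:)
    finally show ?thesis using True deg_A edge_ends(1) by (simp add: mat_scale_def ball_BB_r)
  next
    case False
    then show ?thesis
      unfolding mat_mult_def mA_apply by (auto simp: mat_scale_def ball_BB_r)
  qed
qed

lemma mat_mult_add_right: "mat_mult E P (Q + Q') = mat_mult E P Q + mat_mult E P Q'"
  by (simp add: mat_mult_def fun_eq_iff algebra_simps sum.distrib)

lemma mat_mult_scale_right: "mat_mult E P (mat_scale c Q) = mat_scale c (mat_mult E P Q)"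
  by (simp add: mat_mult_def mat_scale_def fun_eq_iff algebra_simps sum_distrib_left)

text \<open>Since \<open>ball_AB 0\<close> is zero, the term k of the general step is missing here,
  which matches F_1 = X + k.\<close>

lemma mBmA_ball_BB_0:
  "mat_mult E mB (mat_mult E mA (ball_BB 0)) = ball_BB 1 + mat_scale (of_nat l) (ball_BB 0)"
proof -
  have "mat_mult E mA (ball_BB 0) = ball_AB (Suc 0)"
    using mA_ball_BB[OF r_pos] by (simp add: ball_AB_0 mat_scale_def fun_eq_iff)
  then show ?thesis using mB_ball_AB[OF r_pos] by simp
qed

text \<open>In the variable nm - k - l this is the recurrence of \<open>F_poly\<close>: the middle
  coefficient k + l is absorbed by the shift, and kl remains.\<close>

lemma mBmA_ball_BB_Suc:
  assumes "Suc i < r"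
  shows "mat_mult E mB (mat_mult E mA (ball_BB (Suc i))) =
    ball_BB (Suc (Suc i)) + mat_scale (of_nat k + of_nat l) (ball_BB (Suc i)) +
    mat_scale (of_nat k * of_nat l) (ball_BB i)"
  unfolding mA_ball_BB[OF assms] mat_mult_add_right mat_mult_scale_right
    mB_ball_AB[OF assms] mB_ball_AB[OF Suc_lessD[OF assms]]
  by (simp add: mat_scale_def fun_eq_iff algebra_simps)

lemma mA_in: "mA \<in> adj_algebra E A B" and mB_in: "mB \<in> adj_algebra E A B"
  by (intro adj_algebra.intros)+

lemma ball_BB_in: "i \<le> r \<Longrightarrow> ball_BB i \<in> adj_algebra E A B"
proof (induction i rule: induct_nat_012)
  case 0 show ?case unfolding ball_BB_0 by (rule mB_in)
next
  case 1
  have "ball_BB (Suc 0) = mat_mult E mB (mat_mult E mA (ball_BB 0)) + mat_scale (- of_nat l) (ball_BB 0)"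
    unfolding mBmA_ball_BB_0 by (simp add: mat_scale_def fun_eq_iff)
  moreover have "\<dots> \<in> adj_algebra E A B"
    unfolding ball_BB_0 by (intro adj_algebra.intros mA_in mB_in)
  ultimately show ?case by (simp only:)
next
  case (ge2 i)
  then have IH: "ball_BB i \<in> adj_algebra E A B" "ball_BB (Suc i) \<in> adj_algebra E A B" by auto
  have "Suc i < r" using ge2 by simp
  have "ball_BB (Suc (Suc i)) = mat_mult E mB (mat_mult E mA (ball_BB (Suc i))) +
      mat_scale (- (of_nat k + of_nat l)) (ball_BB (Suc i)) +
      mat_scale (- (of_nat k * of_nat l)) (ball_BB i)"
    unfolding mBmA_ball_BB_Suc[OF \<open>Suc i < r\<close>]
    by (simp add: mat_scale_def fun_eq_iff algebra_simps)
  moreover have "\<dots> \<in> adj_algebra E A B"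
    by (intro adj_algebra.add adj_algebra.mult adj_algebra.scale mA_in mB_in IH)
  ultimately show ?case by (simp only:)
qed

end


section \<open>The eigenmatrix attached to a zero of F_r\<close>

locale girth_biregular_root = girth_biregular +
  fixes t :: complex
  assumes root: "cheb t (of_nat k * of_nat l) (Suc r) + of_nat k * cheb t (of_nat k * of_nat l) r = 0"
    and dist_ex: "\<exists>u\<in>B. \<exists>v\<in>B. gdist E u v = 2 * r"
begin

abbreviation "kl \<equiv> of_nat k * of_nat l :: complex"

abbreviation "\<theta> \<equiv> t + of_nat k + of_nat l"

text \<open>Stated for an arbitrary family, so that multiplication by \<open>mA\<close> and
  \<open>mB\<close> can be moved inside and applied to each ball matrix.\<close>

definition comb :: "(nat \<Rightarrow> 'a set matrix_on) \<Rightarrow> 'a set matrix_on" where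
  "comb Q = (\<lambda>e f. Q r e f + (t - kl - 1) * cheb_conv t kl (\<lambda>i. Q i e f) r)"

definition eig :: "'a set matrix_on" where
  "eig = comb ball_BB"

lemma mat_mult_comb: "mat_mult E P (comb Q) = comb (\<lambda>i. mat_mult E P (Q i))"
proof (intro ext)
  fix e f
  have "(\<Sum>g\<in>E. P e g * cheb_conv t kl (\<lambda>i. Q i g f) r) =
      (\<Sum>g\<in>E. \<Sum>i<r. cheb t kl (r - i) * (P e g * Q i g f))"
    by (simp add: cheb_conv_def sum_distrib_left mult_ac)
  also have "\<dots> = cheb_conv t kl (\<lambda>i. mat_mult E P (Q i) e f) r"
    by (subst sum.swap) (simp add: cheb_conv_def mat_mult_def sum_distrib_left)
  finally have "cheb_conv t kl (\<lambda>i. mat_mult E P (Q i) e f) r =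
      (\<Sum>g\<in>E. P e g * cheb_conv t kl (\<lambda>i. Q i g f) r)" ..
  then show "mat_mult E P (comb Q) e f = comb (\<lambda>i. mat_mult E P (Q i)) e f"
    by (simp add: comb_def mat_mult_def algebra_simps sum.distrib sum_distrib_left sum_subtractf)
qed

lemma comb_scale: "comb (\<lambda>i. mat_scale a (Q i)) = mat_scale a (comb Q)"
  by (simp add: comb_def mat_scale_def fun_eq_iff cheb_conv_def sum_distrib_left algebra_simps)

lemma mB_eig: "mat_mult E mB eig = mat_scale (of_nat (Suc l)) eig"
  unfolding eig_def mat_mult_comb mB_ball_BB comb_scale ..

lemma mB_mA_eig: "mat_mult E mB (mat_mult E mA eig) = mat_scale \<theta> eig"
proof (intro ext)
  fix e f
  let ?x = "\<lambda>i. ball_BB i e f"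
  let ?y = "\<lambda>i. mat_mult E mB (mat_mult E mA (ball_BB i)) e f"
  have "cheb_conv t kl ?y r = \<theta> * cheb_conv t kl ?x r + ?x r -
      (cheb t kl (Suc r) + of_nat k * cheb t kl r) * ?x 0"
    by (rule cheb_conv_division)
      (simp_all add: mBmA_ball_BB_0 mBmA_ball_BB_Suc mat_scale_def del: of_nat_Suc)
  \<comment> \<open>The remainder of the division by X - t is the value of F_r at t, which is
    zero.\<close>
  then have conv: "cheb_conv t kl ?y r = \<theta> * cheb_conv t kl ?x r + ?x r"
    by (simp only: root) simp
  have "?y r = of_nat (Suc k) * of_nat (Suc l) * ?x r"
    unfolding mA_ball_BB_r mat_mult_scale_right mB_ball_BB by (simp add: mat_scale_def)
  then show "mat_mult E mB (mat_mult E mA eig) e f = mat_scale \<theta> eig e f"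
    unfolding eig_def mat_mult_comb unfolding comb_def conv mat_scale_def
    by (simp add: algebra_simps)
qed

lemma ball_BB_sym: "ball_BB i e f = ball_BB i f e"
  using gdist_commute ends_in_V by (auto simp: ball_BB_def)

lemma eig_sym: "eig e f = eig f e"
  unfolding eig_def comb_def ball_BB_sym[of _ e f] ..

lemma eig_mB: "mat_mult E eig mB = mat_scale (of_nat (Suc l)) eig"
proof (intro ext)
  fix e f
  have "mB e f = mB f e" for e f unfolding mB_apply by auto
  then have "mat_mult E eig mB e f = mat_mult E mB eig f e"
    unfolding mat_mult_def by (simp only: eig_sym[of e] mult.commute)
  then show "mat_mult E eig mB e f = mat_scale (of_nat (Suc l)) eig e f"
    unfolding mB_eig mat_scale_def eig_sym[of f e] .
qed

lemma eig_outside: "e \<notin> E \<or> f \<notin> E \<Longrightarrow> eig e f = 0"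
  by (auto simp: eig_def comb_def ball_BB_def cheb_conv_def)

lemma sum_in_adj_algebra:
  "finite I \<Longrightarrow> (\<And>i. i \<in> I \<Longrightarrow> P i \<in> adj_algebra E A B) \<Longrightarrow> (\<Sum>i\<in>I. P i) \<in> adj_algebra E A B"
proof (induction I rule: finite_induct)
  case empty
  have "mat_scale 0 (mat_one E) = 0" by (simp add: mat_scale_def fun_eq_iff)
  then show ?case using adj_algebra.scale[OF adj_algebra.one[of E A B], of 0]
    by (simp only: sum.empty)
next
  case (insert i I)
  then show ?case unfolding sum.insert[OF insert.hyps] by (intro adj_algebra.add) simp_all
qed

lemma eig_in: "eig \<in> adj_algebra E A B"
proof -
  have "eig = ball_BB r +
      mat_scale (t - kl - 1) (\<Sum>i\<in>{..<r}. mat_scale (cheb t kl (r - i)) (ball_BB i))"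
    by (simp add: eig_def comb_def fun_eq_iff cheb_conv_def mat_scale_def sum_fun_apply)
  also have "\<dots> \<in> adj_algebra E A B"
    by (intro adj_algebra.add adj_algebra.scale sum_in_adj_algebra ball_BB_in) auto
  finally show ?thesis .
qed

text \<open>Every diagonal entry is 1 + (t - kl - 1) times a sum of Chebyshev values; the factor
  telescopes the sum, and the root equation eliminates the highest term.\<close>

lemma eig_trace: "(\<Sum>e\<in>E. eig e e) = of_nat (card E) * (- (of_nat k * of_nat (Suc l) * cheb t kl r))"
proof -
  have "eig e e = - (of_nat k * of_nat (Suc l) * cheb t kl r)" if "e \<in> E" for e
  proof -
    have "ball_BB i e e = 1" for i using that by (simp add: ball_BB_def)
    then have "eig e e = 1 + (t - kl - 1) * (\<Sum>i<r. cheb t kl (r - i))"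
      by (simp add: eig_def comb_def cheb_conv_def)
    also have "\<dots> = cheb t kl (Suc r) - kl * cheb t kl r"
      unfolding cheb_sum_rev by simp
    also have "cheb t kl (Suc r) = - (of_nat k * cheb t kl r)"
      using root by (simp only: eq_neg_iff_add_eq_0)
    finally show ?thesis by (simp add: algebra_simps)
  qed
  then show ?thesis by simp
qed

text \<open>The eigenvalue of \<open>eig\<close> on its image: the quotient contributes the
  derivative of F_r at t, \<open>ball_BB 0\<close> the factor l + 1, and \<open>ball_BB r\<close>
  the value of F_r at t, which is zero.\<close>

definition \<mu> :: complex where
  "\<mu> = (t - kl - 1) * of_nat (Suc l) * F_deriv t kl (of_nat k) r"

text \<open>On an eigenvector of \<open>mB mA\<close> in the image of \<open>mB\<close>, the matrix \<open>ball_BB i\<close> acts as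
  \<open>(l + 1)\<close> times \<open>F i\<close> at \<open>t\<close>.\<close>

lemma eig_act:
  assumes w: "mat_act E mB w = vec_scale (of_nat (Suc l)) w"
    "mat_act E mB (mat_act E mA w) = vec_scale \<theta> w"
  shows "mat_act E eig w = vec_scale \<mu> w"
proof -
  define F where "F i = cheb t kl (Suc i) + of_nat k * cheb t kl i" for i
  have w0: "mat_act E (ball_BB 0) w = vec_scale (of_nat (Suc l)) w"
    unfolding ball_BB_0 by (rule w(1))
  have "mat_act E (ball_BB i) w = vec_scale (of_nat (Suc l) * F i) w" if "i \<le> r" for i
    using that
  proof (induction i rule: induct_nat_012)
    case 0
    have "F 0 = 1" by (simp add: F_def)
    then show ?case unfolding ball_BB_0 w(1) by (simp only: mult_1_right)
  next
    case 1
    have "mat_act E (ball_BB 1 + mat_scale (of_nat l) (ball_BB 0)) w =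
        mat_act E mB (mat_act E mA (mat_act E (ball_BB 0) w))"
      unfolding mBmA_ball_BB_0[symmetric] mat_act_mult ..
    also have "\<dots> = vec_scale (of_nat (Suc l)) (vec_scale \<theta> w)"
      unfolding ball_BB_0 w mat_act_scale ..
    finally have eq: "mat_act E (ball_BB 1) w + vec_scale (of_nat l) (vec_scale (of_nat (Suc l)) w) =
        vec_scale (of_nat (Suc l)) (vec_scale \<theta> w)"
      unfolding mat_act_plus_mat mat_act_scale_mat w0 .
    have "mat_act E (ball_BB 1) w e + of_nat l * (of_nat (Suc l) * w e) =
        of_nat (Suc l) * (\<theta> * w e)" for e
      using fun_cong[OF eq, of e] by (simp only: plus_fun_apply vec_scale_def)
    then have "mat_act E (ball_BB 1) w e = of_nat (Suc l) * (\<theta> * w e) - of_nat l * (of_nat (Suc l) * w e)" for e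
      by (simp only: eq_diff_eq)
    then show ?case by (simp add: vec_scale_def fun_eq_iff F_def algebra_simps)
  next
    case (ge2 i)
    then have IH: "mat_act E (ball_BB i) w = vec_scale (of_nat (Suc l) * F i) w"
      "mat_act E (ball_BB (Suc i)) w = vec_scale (of_nat (Suc l) * F (Suc i)) w" by auto
    have "Suc i < r" using ge2 by simp
    have "mat_act E (ball_BB (Suc (Suc i)) + mat_scale (of_nat k + of_nat l) (ball_BB (Suc i)) +
        mat_scale kl (ball_BB i)) w =
        mat_act E mB (mat_act E mA (mat_act E (ball_BB (Suc i)) w))"
      unfolding mBmA_ball_BB_Suc[OF \<open>Suc i < r\<close>, symmetric] mat_act_mult ..
    also have "\<dots> = vec_scale (of_nat (Suc l) * F (Suc i)) (vec_scale \<theta> w)"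
      unfolding IH mat_act_scale w ..
    finally have eq: "mat_act E (ball_BB (Suc (Suc i))) w +
        vec_scale (of_nat k + of_nat l) (vec_scale (of_nat (Suc l) * F (Suc i)) w) +
        vec_scale kl (vec_scale (of_nat (Suc l) * F i) w) =
        vec_scale (of_nat (Suc l) * F (Suc i)) (vec_scale \<theta> w)"
      unfolding mat_act_plus_mat mat_act_scale_mat IH .
    have "mat_act E (ball_BB (Suc (Suc i))) w e +
        (of_nat k + of_nat l) * (of_nat (Suc l) * F (Suc i) * w e) +
        kl * (of_nat (Suc l) * F i * w e) =
        of_nat (Suc l) * F (Suc i) * (\<theta> * w e)" for e
      using fun_cong[OF eq, of e] by (simp only: plus_fun_apply vec_scale_def)
    then have "mat_act E (ball_BB (Suc (Suc i))) w e = of_nat (Suc l) * F (Suc i) * (\<theta> * w e) -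
        kl * (of_nat (Suc l) * F i * w e) -
        (of_nat k + of_nat l) * (of_nat (Suc l) * F (Suc i) * w e)" for e
      by (simp only: eq_diff_eq)
    then show ?case by (simp add: vec_scale_def fun_eq_iff F_def algebra_simps)
  qed
  then have ball: "(\<Sum>f\<in>E. ball_BB i e f * w f) = of_nat (Suc l) * F i * w e" if "i \<le> r" for i e
    using that by (simp add: mat_act_def vec_scale_def fun_eq_iff)
  show ?thesis
  proof
    fix e
    have "mat_act E eig w e = (\<Sum>f\<in>E. ball_BB r e f * w f) +
        (t - kl - 1) * (\<Sum>f\<in>E. \<Sum>i<r. cheb t kl (r - i) * (ball_BB i e f * w f))"
      unfolding mat_act_def eig_def comb_def cheb_conv_def
      by (simp add: sum.distrib distrib_right sum_distrib_left sum_distrib_right mult.assoc)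
    also have "(\<Sum>f\<in>E. \<Sum>i<r. cheb t kl (r - i) * (ball_BB i e f * w f)) =
        (\<Sum>i<r. cheb t kl (r - i) * (of_nat (Suc l) * F i * w e))"
      by (subst sum.swap) (simp add: ball flip: sum_distrib_left del: of_nat_Suc)
    also have "\<dots> = of_nat (Suc l) * F_deriv t kl (of_nat k) r * w e"
      unfolding F_deriv_def cheb_conv_def F_def[symmetric] sum_distrib_left sum_distrib_right
      by (simp add: mult_ac del: of_nat_Suc)
    also have "(\<Sum>f\<in>E. ball_BB r e f * w f) = 0"
      using ball[of r e] root by (simp add: F_def del: cheb.simps)
    finally show "mat_act E eig w e = vec_scale \<mu> w e"
      by (simp add: \<mu>_def vec_scale_def mult.assoc del: of_nat_Suc)
  qed
qed

text \<open>For two edges whose ends in \<open>B\<close> are at distance exactly 2r, only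
  \<open>ball_BB r\<close> has a nonzero entry, and the entry of \<open>eig\<close> is 1.\<close>

lemma eig_nonzero: "\<exists>f\<in>E. \<exists>e\<in>E. eig e f \<noteq> 0"
proof -
  interpret swap: bipartite_graph V B A E by (rule swap)
  have edge: "\<exists>e\<in>E. edge_end B e = b" if "b \<in> B" for b
  proof -
    have "nbrs E b \<noteq> {}" using deg_B[OF that] by force
    then obtain a where "{b, a} \<in> E" by (auto simp: nbrs_def)
    then show ?thesis using swap.edge_end_doubleton that by blast
  qed
  obtain u v where uv: "u \<in> B" "v \<in> B" "gdist E u v = 2 * r" using dist_ex by blast
  obtain e f where ef: "e \<in> E" "f \<in> E" "edge_end B e = u" "edge_end B f = v"
    using edge uv by metis
  have "ball_BB i e f = 0" if "i < r" for i using ef uv that by (simp add: ball_BB_def)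
  moreover have "ball_BB r e f = 1" using ef by (simp add: ball_BB_r)
  ultimately have "eig e f = 1" by (simp add: eig_def comb_def cheb_conv_def)
  then show ?thesis using ef by force
qed

lemma eig_column:
  assumes "w = mat_act E eig v"
  shows "w \<in> vec_space E" "mat_act E mB w = vec_scale (of_nat (Suc l)) w"
    "mat_act E mB (mat_act E mA w) = vec_scale \<theta> w"
proof -
  show "w \<in> vec_space E" using assms eig_outside by (auto simp: vec_space_def mat_act_def)
  show "mat_act E mB w = vec_scale (of_nat (Suc l)) w"
    unfolding assms mat_act_mult[symmetric] mB_eig mat_act_scale_mat ..
  show "mat_act E mB (mat_act E mA w) = vec_scale \<theta> w"
    unfolding assms mat_act_mult[symmetric] mB_mA_eig mat_act_scale_mat ..
qed

text \<open>\<open>\<theta>\<close> is an eigenvalue of a positive semidefinite form: it is the ratio of \<open>\<langle>mA w, w\<rangle>\<close>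
  and \<open>\<langle>w, w\<rangle>\<close> up to positive factors.\<close>

lemma \<theta>_nonneg: "\<exists>x\<ge>0. \<theta> = of_real x"
proof -
  obtain f where f: "f \<in> E" "\<exists>e\<in>E. eig e f \<noteq> 0" using eig_nonzero by blast
  define w where "w = mat_act E eig (delta f)"
  note w = eig_column[OF w_def]
  have "w \<noteq> 0" using f mat_act_delta[OF finite_E] by (auto simp: w_def fun_eq_iff)
  define a where "a = (\<Sum>e\<in>E. (cmod (w e))\<^sup>2)"
  define b where "b = (\<Sum>e\<in>E. (cmod (mat_act E mA w e))\<^sup>2)"
  have a: "herm E w w = of_real a" and b: "herm E (mat_act E mA w) (mat_act E mA w) = of_real b"
    by (simp_all add: a_def b_def herm_self_of_real)
  have "a \<noteq> 0"
  proof
    assume "a = 0"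
    then have "herm E w w = 0" unfolding a by simp
    then show False using herm_self_eq_0[OF finite_E w(1)] \<open>w \<noteq> 0\<close> by blast
  qed
  moreover have "a \<ge> 0" "b \<ge> 0" by (simp_all add: a_def b_def sum_nonneg)
  ultimately have "a > 0" by simp
  have adjA: "adjoint_mat mA = mA" and adjB: "adjoint_mat mB = mB"
    unfolding adjoint_mat_def fun_eq_iff mA_apply mB_apply by auto
  \<comment> \<open>Moving \<open>mB\<close> across the form produces l + 1, and
    \<open>mA_mA\<close> turns <mA w, w> into a squared norm: (k + 1) \<theta> <w, w> = (l + 1) <mA
    w, mA w>.\<close>
  have "of_nat (Suc k) * \<theta> * of_real a = of_nat (Suc k) * herm E (mat_act E mB (mat_act E mA w)) w"
    unfolding w(3) herm_scale_left a by (simp only: mult.assoc)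
  also have "\<dots> = of_nat (Suc k) * herm E (mat_act E mA w) (vec_scale (of_nat (Suc l)) w)"
    unfolding herm_mat_act adjB w(2) ..
  also have "\<dots> = of_nat (Suc l) * herm E (vec_scale (of_nat (Suc k)) (mat_act E mA w)) w"
    unfolding herm_def vec_scale_def by (simp add: sum_distrib_left mult_ac del: of_nat_Suc)
  also have "vec_scale (of_nat (Suc k)) (mat_act E mA w) = mat_act E mA (mat_act E mA w)"
    unfolding mat_act_mult[symmetric] mA_mA mat_act_scale_mat ..
  also have "herm E (mat_act E mA (mat_act E mA w)) w = of_real b"
    unfolding herm_mat_act[of E mA "mat_act E mA w"] adjA b ..
  finally have "\<theta> = of_real (real (Suc l) * b / (real (Suc k) * a))"
    using \<open>a > 0\<close> by (simp add: field_simps del: of_nat_Suc)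
  moreover have "real (Suc l) * b / (real (Suc k) * a) \<ge> 0"
    using \<open>a > 0\<close> \<open>b \<ge> 0\<close> by (intro divide_nonneg_nonneg mult_nonneg_nonneg) simp_all
  ultimately show ?thesis by blast
qed

lemma t_real: "t \<in> \<real>"
proof -
  obtain x where "\<theta> = of_real x" using \<theta>_nonneg by blast
  then have "t = of_real (x - real k - real l)" by (simp add: algebra_simps)
  then show ?thesis by (metis Reals_of_real)
qed

lemma cheb_real: "cheb t kl n \<in> \<real>"
  using t_real by (induction n rule: induct_nat_012) auto

lemma eig_real: "eig e f \<in> \<real>"
  unfolding eig_def comb_def cheb_conv_def
  using t_real cheb_real
  by (intro Reals_add Reals_mult Reals_diff sum_in_Reals) (auto simp: ball_BB_def)

text \<open>A nonzero Hermitian matrix is not nilpotent: \<open>eig\<close> is real symmetric, so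
  the squared norm of its column \<open>w\<close> at \<open>f\<close> is the entry at
  \<open>f\<close> of \<open>eig\<close> applied to \<open>w\<close>, that is
  \<open>\<mu> * w f\<close>. In particular t differs from kl + 1 and is a simple zero of
  F_r.\<close>

lemma \<mu>_nonzero: "\<mu> \<noteq> 0"
proof
  assume 0: "\<mu> = 0"
  obtain f where f: "f \<in> E" "\<exists>e\<in>E. eig e f \<noteq> 0" using eig_nonzero by blast
  define w where "w = mat_act E eig (delta f)"
  note w = eig_column[OF w_def]
  have we: "w e = eig e f" for e using f mat_act_delta[OF finite_E] by (simp add: w_def)
  have "cnj (w e) = eig f e" for e
    using eig_real[of e f] eig_sym[of e f] by (simp add: we Reals_cnj_iff)
  then have "herm E w w = mat_act E eig w f"
    by (simp add: herm_def mat_act_def mult.commute)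
  also have "\<dots> = 0" using eig_act[OF w(2,3)] 0 by (simp add: vec_scale_def)
  finally have "w = 0" using herm_self_eq_0[OF finite_E w(1)] by blast
  then show False using f(2) we by (auto simp: fun_eq_iff)
qed

end


section \<open>The two-dimensional representation\<close>

lemma UNIV_2_sum: "(\<Sum>i\<in>(UNIV :: 2 set). f i) = f 1 + f 2"
  by (simp add: UNIV_2)

lemma vec2_eq_iff: "x = y \<longleftrightarrow> x $ 1 = y $ 1 \<and> x $ 2 = y $ 2" for x y :: "'a ^ 2"
  by (simp add: vec_eq_iff forall_2)

lemma rep_M_mult: "(rep_M k *v x) $ 1 = of_nat k * x $ 1" "(rep_M k *v x) $ 2 = - (x $ 2)"
  by (simp_all add: rep_M_def matrix_vector_mult_def UNIV_2_sum)

lemma rep_N_mult: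
  "(rep_N k l t z *v x) $ 1 = (t + of_nat l - 1) / (of_nat k + 1) * x $ 1 + z * x $ 2"
  "(rep_N k l t z *v x) $ 2 = z * x $ 1 + (of_nat k * of_nat l - of_nat k - t) / (of_nat k + 1) * x $ 2"
  by (simp_all add: rep_N_def matrix_vector_mult_def UNIV_2_sum Let_def)

lemma matrix_scale_mult: "(\<chi> i j. c * A $ i $ j) *v x = c *s (A *v x)"
  for A :: "complex ^ 'n ^ 'm"
  by (simp add: matrix_vector_mult_def vec_eq_iff sum_distrib_left mult.assoc)

section \<open>Coordinates on a submodule generated by an eigenvector\<close>

locale girth_biregular_rep = girth_biregular_root +
  fixes z :: complex
  assumes k_pos: "k > 0" and l_pos: "l > 0"
    and z_square: "z\<^sup>2 = (1 + kl - t) * (t + of_nat k + of_nat l) / (of_nat k + 1)\<^sup>2"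
begin

abbreviation "\<A> \<equiv> adj_algebra E A B"

definition K :: complex where "K = of_nat k + 1"

text \<open>\<theta> / K and \<eta> / K are the diagonal entries of the image of \<open>mB\<close>
  in the representation. Their sum is l + 1 and their product is the square of z, so this image has
  rank one.\<close>

definition \<eta> :: complex where "\<eta> = 1 + kl - t"

lemma K_nonzero: "K \<noteq> 0"
  unfolding K_def by (metis of_nat_Suc of_nat_neq_0 add.commute)

lemma \<eta>_nonzero: "\<eta> \<noteq> 0"
  using \<mu>_nonzero by (auto simp: \<mu>_def \<eta>_def)

lemma \<theta>_nonzero: "\<theta> \<noteq> 0"
proof
  assume "\<theta> = 0"
  then have "t = - of_nat k - of_nat l" by (simp add: eq_neg_iff_add_eq_0 algebra_simps)
  then show False using root F_at_minus_sum[of "of_nat k :: complex" "of_nat l" r] l_pos by simp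
qed

lemma z_square': "z * z = \<eta> * \<theta> / (K * K)"
  using z_square by (simp add: power2_eq_square K_def \<eta>_def)

lemma z_nonzero: "z \<noteq> 0"
  using z_square' \<eta>_nonzero \<theta>_nonzero K_nonzero by auto

lemma \<theta>_plus_\<eta>: "of_nat (Suc l) = (\<theta> + \<eta>) / K"
  using K_nonzero by (simp add: field_simps) (simp add: K_def \<eta>_def algebra_simps)

lemma rep_N_x: "(t + of_nat l - 1) / (of_nat k + 1) = \<theta> / K - 1"
  using K_nonzero unfolding K_def by (simp add: field_simps)

lemma rep_N_y: "(kl - of_nat k - t) / (of_nat k + 1) = \<eta> / K - 1"
  using K_nonzero unfolding K_def \<eta>_def by (simp add: field_simps)

text \<open>These vectors detect the representation: an irreducible submodule is isomorphic to it
  exactly if it contains one of them.\<close>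

definition eigvec :: "'a set vector_on \<Rightarrow> bool" where
  "eigvec v \<longleftrightarrow> v \<in> vec_space E \<and> v \<noteq> 0 \<and>
    mat_act E mB v = vec_scale (of_nat (Suc l)) v \<and>
    mat_act E mB (mat_act E mA v) = vec_scale \<theta> v"

lemma mA_act: "mat_act E mA v = mat_act E (share_mat E A) v + v"
  and mB_act: "mat_act E mB v = mat_act E (share_mat E B) v + v" if "v \<in> vec_space E"
  using mat_act_one[OF finite_E that] by (simp_all only: mat_act_plus_mat)

text \<open>The coordinates are chosen so that the first basis vector is mapped to a multiple of
  \<open>mA v\<close>, the second one to a multiple of \<open>v - mA v / (k + 1)\<close>, which \<open>mA\<close> annihilates.\<close>

definition emb :: "'a set vector_on \<Rightarrow> complex ^ 2 \<Rightarrow> 'a set vector_on" where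
  "emb v x = vec_scale (x $ 2 * \<theta> / K) v +
    vec_scale (x $ 1 * z / K - x $ 2 * \<theta> / (K * K)) (mat_act E mA v)"

lemma linear_emb: "Vector_Spaces.linear (*s) vec_scale (emb v)"
  by unfold_locales (auto simp: emb_def vec_scale_def fun_eq_iff field_simps add_divide_distrib)

lemma emb_in_submodule:
  assumes "submodule_on E \<A> W" "v \<in> W"
  shows "emb v x \<in> W"
proof -
  have "mat_act E mA v \<in> W" using assms mA_in unfolding submodule_on_def by blast
  then show ?thesis using assms(2) submodule_subspace[OF assms(1)] unfolding emb_def
    by (intro edge_space.subspace_add edge_space.subspace_scale)
qed

lemma mA_mA_act: "mat_act E mA (mat_act E mA v) = vec_scale K (mat_act E mA v)"
  unfolding mat_act_mult[symmetric] mA_mA mat_act_scale_mat by (simp add: K_def add.commute)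

lemma mA_emb: "mat_act E mA (emb v x) = vec_scale (x $ 1 * z) (mat_act E mA v)"
proof -
  have "mat_act E mA (emb v x) = vec_scale (x $ 2 * \<theta> / K) (mat_act E mA v) +
      vec_scale (x $ 1 * z / K - x $ 2 * \<theta> / (K * K)) (vec_scale K (mat_act E mA v))"
    unfolding emb_def mat_act_add mat_act_scale mA_mA_act ..
  also have "\<dots> = vec_scale (x $ 1 * z) (mat_act E mA v)"
    using K_nonzero by (simp add: vec_scale_def fun_eq_iff field_simps)
  finally show ?thesis .
qed

lemma mB_emb:
  assumes "eigvec v"
  shows "mat_act E mB (emb v x) = vec_scale (x $ 1 * z * \<theta> / K + x $ 2 * \<theta> * \<eta> / (K * K)) v"
proof -
  have "mat_act E mB (emb v x) = vec_scale (x $ 2 * \<theta> / K) (vec_scale (of_nat (Suc l)) v) +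
      vec_scale (x $ 1 * z / K - x $ 2 * \<theta> / (K * K)) (vec_scale \<theta> v)"
    using assms unfolding emb_def mat_act_add mat_act_scale eigvec_def by simp
  also have "\<dots> = vec_scale (x $ 1 * z * \<theta> / K + x $ 2 * \<theta> * \<eta> / (K * K)) v"
    unfolding \<theta>_plus_\<eta> using K_nonzero by (simp add: vec_scale_def fun_eq_iff field_simps)
  finally show ?thesis .
qed

lemma emb_in_vec_space: "eigvec v \<Longrightarrow> emb v x \<in> vec_space E"
  by (rule emb_in_submodule[OF std_submodule]) (simp add: eigvec_def)

lemma emb_rep_M:
  assumes "eigvec v"
  shows "emb v (rep_M k *v x) = mat_act E (share_mat E A) (emb v x)"
proof -
  have "mat_act E (share_mat E A) (emb v x) = mat_act E mA (emb v x) - emb v x"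
    unfolding mA_act[OF emb_in_vec_space[OF assms]] by simp
  also have "\<dots> = emb v (rep_M k *v x)"
    unfolding mA_emb unfolding emb_def rep_M_mult
    using K_nonzero by (simp add: vec_scale_def fun_eq_iff field_simps) (simp add: K_def algebra_simps)
  finally show ?thesis ..
qed

lemma emb_rep_N:
  assumes "eigvec v"
  shows "emb v (rep_N k l t z *v x) = mat_act E (share_mat E B) (emb v x)"
proof -
  let ?y = "rep_N k l t z *v x"
  have 1: "?y $ 2 * \<theta> / K = x $ 1 * z * \<theta> / K + x $ 2 * \<theta> * \<eta> / (K * K) - x $ 2 * \<theta> / K"
    unfolding rep_N_mult rep_N_y using K_nonzero by (simp add: field_simps)
  \<comment> \<open>\<open>mB\<close> maps into multiples of \<open>v\<close>, so the coefficient of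
    \<open>mA v\<close> must change sign. The grouping isolates the difference that vanishes by the
    choice of z.\<close>
  have "?y $ 1 * z / K - ?y $ 2 * \<theta> / (K * K) =
      x $ 2 * (z * z - \<eta> * \<theta> / (K * K)) / K - (x $ 1 * z / K - x $ 2 * \<theta> / (K * K))"
    unfolding rep_N_mult rep_N_y rep_N_x using K_nonzero by (simp add: field_simps)
  then have 2: "?y $ 1 * z / K - ?y $ 2 * \<theta> / (K * K) = - (x $ 1 * z / K - x $ 2 * \<theta> / (K * K))"
    by (simp add: z_square')
  have "mat_act E (share_mat E B) (emb v x) = mat_act E mB (emb v x) - emb v x"
    unfolding mB_act[OF emb_in_vec_space[OF assms]] by simp
  also have "\<dots> = emb v ?y"
    unfolding mB_emb[OF assms] unfolding emb_def 1 2
    by (simp add: vec_scale_def fun_eq_iff algebra_simps)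
  finally show ?thesis ..
qed

text \<open>Applying \<open>mA\<close> isolates the first coordinate and then \<open>mB\<close> the
  second; their factors are nonzero because z, \<theta> and \<eta> are.\<close>

lemma emb_eq_0:
  assumes v: "eigvec v" and 0: "emb v x = 0"
  shows "x = 0"
proof -
  have "mat_act E mA v \<noteq> 0"
  proof
    assume "mat_act E mA v = 0"
    then have "vec_scale \<theta> v = 0" using v by (simp only: eigvec_def mat_act_zero)
    then show False using v \<theta>_nonzero edge_space.scale_eq_0_iff by (auto simp: eigvec_def)
  qed
  moreover have "vec_scale (x $ 1 * z) (mat_act E mA v) = 0"
    unfolding mA_emb[symmetric] 0 by (rule mat_act_zero)
  ultimately have x1: "x $ 1 = 0"
    using z_nonzero unfolding edge_space.scale_eq_0_iff by simp
  have "vec_scale (x $ 1 * z * \<theta> / K + x $ 2 * \<theta> * \<eta> / (K * K)) v = 0"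
    unfolding mB_emb[OF v, symmetric] 0 by (rule mat_act_zero)
  then have "x $ 2 = 0"
    using v \<theta>_nonzero \<eta>_nonzero K_nonzero x1
    unfolding edge_space.scale_eq_0_iff by (auto simp: eigvec_def)
  then show ?thesis using x1 by (simp add: vec2_eq_iff)
qed

lemma emb_add: "emb v (x + y) = emb v x + emb v y"
  and emb_scale: "emb v (c *s x) = vec_scale c (emb v x)"
  by (auto simp: emb_def vec_scale_def fun_eq_iff field_simps add_divide_distrib)

lemma inj_emb:
  assumes "eigvec v"
  shows "inj (emb v)"
proof (rule injI)
  fix x y assume "emb v x = emb v y"
  then have "emb v (x + (-1) *s y) = 0"
    unfolding emb_add emb_scale by (simp add: vec_scale_def fun_eq_iff)
  then have "x + (-1) *s y = 0" by (rule emb_eq_0[OF assms])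
  then show "x = y" by (simp add: vec2_eq_iff)
qed

lemma range_emb_invariant:
  assumes "eigvec v" "P \<in> \<A>"
  shows "\<exists>y. mat_act E P (emb v x) = emb v y"
  using assms(2)
proof (induction arbitrary: x)
  case one
  then show ?case using mat_act_one[OF finite_E emb_in_vec_space[OF assms(1)]] by blast
next
  case genM then show ?case using emb_rep_M[OF assms(1)] by metis
next
  case genN then show ?case using emb_rep_N[OF assms(1)] by metis
next
  case (add P Q) then show ?case unfolding mat_act_plus_mat by (metis emb_add)
next
  case (scale P c) then show ?case unfolding mat_act_scale_mat by (metis emb_scale)
next
  case (mult P Q) then show ?case unfolding mat_act_mult by metis
qed

lemma range_emb_submodule:
  assumes "eigvec v"
  shows "submodule_on E \<A> (range (emb v))"
  unfolding submodule_on_def edge_space.subspace_def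
proof (intro conjI ballI allI)
  show "range (emb v) \<subseteq> vec_space E" using emb_in_vec_space[OF assms] by auto
  have "emb v 0 = 0" by (simp add: emb_def vec_scale_def fun_eq_iff)
  then show "0 \<in> range (emb v)" by (metis rangeI)
  show "x + y \<in> range (emb v)" if "x \<in> range (emb v)" "y \<in> range (emb v)" for x y
    using that by (auto simp only: emb_add[symmetric])
  show "vec_scale c x \<in> range (emb v)" if "x \<in> range (emb v)" for c x
    using that by (auto simp only: emb_scale[symmetric])
  show "mat_act E P x \<in> range (emb v)" if "P \<in> \<A>" "x \<in> range (emb v)" for P x
    using that range_emb_invariant[OF assms that(1)] by auto
qed

lemma eigvec_eig:
  assumes "mat_act E eig w \<noteq> 0"
  shows "eigvec (mat_act E eig w)"
  using eig_column[OF refl, of w] assms by (simp only: eigvec_def) simp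

lemma eigvec_exists: "\<exists>v. eigvec v"
proof -
  obtain e f where "f \<in> E" "eig e f \<noteq> 0" using eig_nonzero by blast
  then have "mat_act E eig (delta f) \<noteq> 0"
    using mat_act_delta[OF finite_E] by (metis zero_fun_apply)
  then show ?thesis using eigvec_eig by blast
qed

text \<open>Prescribed values on generators need not extend to the algebra. Here they do, because
  they are the coordinate matrices of the action on \<open>range (emb v)\<close>; injectivity of
  \<open>emb v\<close> transfers all algebraic laws.\<close>

lemma rep_exists:
  "\<exists>\<rho>. algebra_rep E \<A> \<rho> \<and> \<rho> (share_mat E A) = rep_M k \<and> \<rho> (share_mat E B) = rep_N k l t z"
proof -
  obtain v where v: "eigvec v" using eigvec_exists by blast
  note inj = injD[OF inj_emb[OF v]]
  obtain g where g: "\<And>P x. P \<in> \<A> \<Longrightarrow> emb v (g P x) = mat_act E P (emb v x)"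
    using range_emb_invariant[OF v] by metis
  define \<rho> where "\<rho> P = matrix (g P)" for P
  have \<rho>: "emb v (\<rho> P *v x) = mat_act E P (emb v x)" if P: "P \<in> \<A>" for P x
  proof -
    have "Vector_Spaces.linear (*s) (*s) (g P)"
    proof unfold_locales
      show "g P (x + y) = g P x + g P y" for x y
        by (rule inj) (simp only: g[OF P] emb_add mat_act_add)
      show "g P (c *s x) = c *s g P x" for c x
        by (rule inj) (simp only: g[OF P] emb_scale mat_act_scale)
    qed
    then show ?thesis unfolding \<rho>_def by (simp only: matrix_works g[OF P])
  qed
  have eqI: "M = M'" if "\<And>x. emb v (M *v x) = emb v (M' *v x)" for M M'
    using that inj by (metis matrix_eq)
  have "\<rho> (mat_one E) = mat 1"
    by (rule eqI) (simp only: \<rho>[OF adj_algebra.one] matrix_vector_mul_lid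
        mat_act_one[OF finite_E emb_in_vec_space[OF v]])
  moreover have "\<rho> (P + Q) = \<rho> P + \<rho> Q" if "P \<in> \<A>" "Q \<in> \<A>" for P Q
    by (rule eqI) (simp only: \<rho> that adj_algebra.add matrix_vector_mult_add_rdistrib emb_add
        mat_act_plus_mat)
  moreover have "\<rho> (mat_scale c P) = (\<chi> i j. c * \<rho> P $ i $ j)" if "P \<in> \<A>" for c P
    by (rule eqI) (simp only: \<rho> that adj_algebra.scale matrix_scale_mult emb_scale
        mat_act_scale_mat)
  moreover have "\<rho> (mat_mult E P Q) = \<rho> P ** \<rho> Q" if "P \<in> \<A>" "Q \<in> \<A>" for P Q
    by (rule eqI) (simp only: \<rho> that adj_algebra.mult matrix_vector_mul_assoc[symmetric]
        mat_act_mult)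
  moreover have "\<rho> (share_mat E A) = rep_M k"
    by (rule eqI) (simp only: \<rho> adj_algebra.genM emb_rep_M[OF v])
  moreover have "\<rho> (share_mat E B) = rep_N k l t z"
    by (rule eqI) (simp only: \<rho> adj_algebra.genN emb_rep_N[OF v])
  ultimately show ?thesis unfolding algebra_rep_def by blast
qed

section \<open>Summands isomorphic to the representation and their number\<close>

abbreviation "rep \<equiv> assoc_rep E A B k l t z"

lemma assoc_rep:
  shows "algebra_rep E \<A> rep" "rep (share_mat E A) = rep_M k" "rep (share_mat E B) = rep_N k l t z"
  using someI_ex[OF rep_exists] unfolding assoc_rep_def by blast+

text \<open>\<open>rep\<close> is an arbitrary choice, but on the algebra it is determined by the
  generators, so it agrees with the action on \<open>range (emb v)\<close>.\<close>

lemma emb_assoc_rep: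
  assumes v: "eigvec v" and "P \<in> \<A>"
  shows "emb v (rep P *v x) = mat_act E P (emb v x)"
  using assms(2)
proof (induction arbitrary: x)
  case one
  have "rep (mat_one E) = mat 1" using assoc_rep(1) by (simp add: algebra_rep_def)
  then show ?case
    by (simp only: mat_act_one[OF finite_E emb_in_vec_space[OF v]] matrix_vector_mul_lid)
next
  case genM then show ?case by (simp only: assoc_rep emb_rep_M[OF v])
next
  case genN then show ?case by (simp only: assoc_rep emb_rep_N[OF v])
next
  case (add P Q)
  have "rep (P + Q) = rep P + rep Q" using assoc_rep(1) add by (simp only: algebra_rep_def)
  then show ?case
    by (simp only: add.IH matrix_vector_mult_add_rdistrib emb_add mat_act_plus_mat)
next
  case (scale P c)
  have "rep (mat_scale c P) = (\<chi> i j. c * rep P $ i $ j)"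
    using assoc_rep(1) scale by (simp only: algebra_rep_def)
  then show ?case by (simp only: scale.IH matrix_scale_mult emb_scale mat_act_scale_mat)
next
  case (mult P Q)
  have "rep (mat_mult E P Q) = rep P ** rep Q"
    using assoc_rep(1) mult by (simp only: algebra_rep_def)
  then show ?case by (simp only: mult.IH matrix_vector_mul_assoc[symmetric] mat_act_mult)
qed

lemma irreducible_eq_range_emb:
  assumes W: "irreducible_submodule E \<A> W" and v: "eigvec v" "v \<in> W"
  shows "W = range (emb v)"
proof -
  have "submodule_on E \<A> W" using W by (simp add: irreducible_submodule_def)
  then have "range (emb v) \<subseteq> W" using emb_in_submodule v(2) by blast
  moreover have "range (emb v) \<noteq> {0}"
  proof
    assume "range (emb v) = {0}"
    then have "emb v (vec 1) = 0" by blast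
    then have "vec 1 = (0 :: complex ^ 2)" by (rule emb_eq_0[OF v(1)])
    then show False by (simp add: vec_eq_iff)
  qed
  ultimately show ?thesis
    using W range_emb_submodule[OF v(1)] unfolding irreducible_submodule_def by blast
qed

lemma submodule_iso_rep_if_eigvec:
  assumes W: "irreducible_submodule E \<A> W" and v: "eigvec v" "v \<in> W"
  shows "submodule_iso_rep E \<A> rep W"
  unfolding submodule_iso_rep_def
proof (intro exI[of _ "emb v"] conjI ballI allI)
  show "Vector_Spaces.linear (*s) vec_scale (emb v)" by (rule linear_emb)
  show "bij_betw (emb v) UNIV W"
    unfolding bij_betw_def irreducible_eq_range_emb[OF assms] using inj_emb[OF v(1)] by simp
qed (rule emb_assoc_rep[OF v(1)])

text \<open>The image of \<open>mB\<close> in the representation is spanned by the first column of its matrix.\<close>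

lemma eigvec_if_submodule_iso_rep:
  assumes W: "irreducible_submodule E \<A> W" and iso: "submodule_iso_rep E \<A> rep W"
  shows "\<exists>v\<in>W. eigvec v"
proof -
  obtain \<phi> where lin: "Vector_Spaces.linear (*s) vec_scale \<phi>" and bij: "bij_betw \<phi> UNIV W"
    and act: "\<And>P x. P \<in> \<A> \<Longrightarrow> \<phi> (rep P *v x) = mat_act E P (\<phi> x)"
    using iso unfolding submodule_iso_rep_def by blast
  interpret lin: Vector_Spaces.linear "(*s)" vec_scale \<phi> by (rule lin)
  have W_vec: "W \<subseteq> vec_space E" using W by (simp add: irreducible_submodule_def submodule_on_def)
  have in_W: "\<phi> x \<in> W" for x using bij by (auto simp: bij_betw_def)
  have in_vec: "\<phi> x \<in> vec_space E" for x using in_W W_vec by blast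
  have actA: "mat_act E mA (\<phi> x) = \<phi> (rep_M k *v x + x)" for x
    unfolding mA_act[OF in_vec] act[OF adj_algebra.genM, symmetric] assoc_rep lin.add ..
  have actB: "mat_act E mB (\<phi> x) = \<phi> (rep_N k l t z *v x + x)" for x
    unfolding mB_act[OF in_vec] act[OF adj_algebra.genN, symmetric] assoc_rep lin.add ..
  define x :: "complex ^ 2" where "x = vector [\<theta> / K, z]"
  have x: "x $ 1 = \<theta> / K" "x $ 2 = z" by (simp_all add: x_def)
  have "rep_N k l t z *v x + x = of_nat (Suc l) *s x"
    using K_nonzero z_square'
    by (simp only: vec2_eq_iff vector_add_component vector_smult_component rep_N_mult rep_N_x
        rep_N_y x \<theta>_plus_\<eta>) (simp add: field_simps)
  then have 1: "mat_act E mB (\<phi> x) = vec_scale (of_nat (Suc l)) (\<phi> x)"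
    unfolding actB by (simp only: lin.scale)
  \<comment> \<open>The image of \<open>mA\<close> is the diagonal matrix with entries K and 0; it
    sends \<open>x\<close> to \<theta> times the first unit vector, and the image of
    \<open>mB\<close> sends that vector to its first column \<open>x\<close>.\<close>
  have "rep_N k l t z *v (rep_M k *v x + x) + (rep_M k *v x + x) = \<theta> *s x"
  proof -
    have k_eq: "of_nat k = K - 1" by (simp add: K_def)
    have *: "of_nat k * (a / K) + a / K = a" for a
      using K_nonzero unfolding k_eq by (simp add: field_simps)
    have y: "(rep_M k *v x + x) $ 1 = \<theta>" "(rep_M k *v x + x) $ 2 = 0"
      unfolding vector_add_component rep_M_mult x by (simp_all only: * left_minus)
    show ?thesis
      unfolding vec2_eq_iff vector_add_component[of "rep_N k l t z *v (rep_M k *v x + x)"]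
        vector_smult_component rep_N_mult rep_N_x rep_N_y x y
      by (simp add: algebra_simps)
  qed
  then have 2: "mat_act E mB (mat_act E mA (\<phi> x)) = vec_scale \<theta> (\<phi> x)"
    unfolding actA actB by (simp only: lin.scale)
  have "\<phi> x \<noteq> 0"
  proof
    assume "\<phi> x = 0"
    then have "\<phi> x = \<phi> 0" by (simp only: lin.zero)
    then have "x = 0" using bij by (metis bij_betw_imp_inj_on injD)
    then show False using x z_nonzero by simp
  qed
  then show ?thesis using 1 2 in_W in_vec unfolding eigvec_def by blast
qed

text \<open>As \<open>eig\<close> absorbs \<open>mB\<close> on the right up to l + 1, a factor
  \<open>mB\<close> may be inserted before \<open>mA v\<close>. Since \<open>range (emb v)\<close>
  is spanned by \<open>v\<close> and \<open>mA v\<close>, \<open>eig\<close> has rank one on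
  it.\<close>

lemma eig_mA_eigvec:
  assumes "eigvec v"
  shows "mat_act E eig (mat_act E mA v) = vec_scale (\<theta> * \<mu> / of_nat (Suc l)) v"
proof -
  define x where "x = mat_act E eig (mat_act E mA v)"
  have "vec_scale (of_nat (Suc l)) x =
      mat_act E eig (mat_act E mB (mat_act E mA v))"
    unfolding x_def mat_act_mult[symmetric, of _ eig mB] eig_mB mat_act_scale_mat ..
  also have "\<dots> = vec_scale \<theta> (mat_act E eig v)"
    using assms by (simp only: eigvec_def mat_act_scale)
  also have "mat_act E eig v = vec_scale \<mu> v" using assms eig_act by (simp only: eigvec_def)
  finally have "of_nat (Suc l) * x e = \<theta> * (\<mu> * v e)" for e
    by (simp add: vec_scale_def fun_eq_iff del: of_nat_Suc)
  then have "x = vec_scale (\<theta> * \<mu> / of_nat (Suc l)) v"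
    using of_nat_neq_0[of l, where 'a = complex]
    by (simp add: vec_scale_def fun_eq_iff field_simps del: of_nat_Suc)
  then show ?thesis unfolding x_def .
qed

text \<open>The right-hand side is independent of \<open>D\<close>, which is what makes the
  description in \<open>multiplicity_in_std\<close> well defined.\<close>

lemma card_summands:
  assumes D: "irreducible_decomposition E \<A> D"
  shows "of_nat (card {W\<in>D. submodule_iso_rep E \<A> rep W}) =
    of_nat (card E) * (- (of_nat k * of_nat (Suc l) * cheb t kl r)) / \<mu>"
proof -
  let ?P = "mat_scale (1 / \<mu>) eig"
  have irr: "irreducible_submodule E \<A> W" if "W \<in> D" for W
    using D that by (simp add: irreducible_decomposition_def)
  have "(\<Sum>e\<in>E. ?P e e) = of_nat (card {W\<in>D. submodule_iso_rep E \<A> rep W})"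
  proof (rule trace_eq_card_summands[where P = ?P, OF finite_E D])
    show "\<exists>w\<in>W. w \<noteq> 0 \<and> mat_act E ?P w = w \<and> (\<forall>v\<in>W. \<exists>c. mat_act E ?P v = vec_scale c w)"
      if W: "W \<in> D" "submodule_iso_rep E \<A> rep W" for W
    proof -
      obtain v where v: "v \<in> W" "eigvec v"
        using eigvec_if_submodule_iso_rep irr W by blast
      have "mat_act E eig v = vec_scale \<mu> v" using v(2) eig_act by (simp only: eigvec_def)
      then have Pv: "mat_act E ?P v = v"
        unfolding mat_act_scale_mat using \<mu>_nonzero by (simp add: vec_scale_def)
      have PA: "mat_act E ?P (mat_act E mA v) = vec_scale (1 / \<mu> * (\<theta> * \<mu> / of_nat (Suc l))) v"
        unfolding mat_act_scale_mat eig_mA_eigvec[OF v(2)] by (simp add: vec_scale_def)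
      have "\<exists>c. mat_act E ?P u = vec_scale c v" if u: "u \<in> W" for u
      proof -
        obtain x where "u = emb v x"
          using u irreducible_eq_range_emb[OF irr[OF W(1)] v(2,1)] by blast
        then show ?thesis
          unfolding emb_def
          by (simp only: mat_act_add mat_act_scale Pv PA edge_space.scale_scale
              edge_space.scale_left_distrib[symmetric]) blast
      qed
      then show ?thesis using v Pv unfolding eigvec_def by blast
    qed
    show "mat_act E ?P v = 0" if "W \<in> D" "\<not> submodule_iso_rep E \<A> rep W" "v \<in> W" for W v
    proof (rule ccontr)
      assume "mat_act E ?P v \<noteq> 0"
      then have "mat_act E eig v \<noteq> 0"
        unfolding mat_act_scale_mat by (auto simp: vec_scale_def fun_eq_iff)
      then have "eigvec (mat_act E eig v)" by (rule eigvec_eig)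
      moreover have "mat_act E eig v \<in> W"
        using irr that eig_in by (simp add: irreducible_submodule_def submodule_on_def)
      ultimately show False using submodule_iso_rep_if_eigvec irr that by blast
    qed
  qed
  moreover have "(\<Sum>e\<in>E. ?P e e) = (\<Sum>e\<in>E. eig e e) / \<mu>"
    by (simp add: mat_scale_def sum_divide_distrib)
  ultimately show ?thesis unfolding eig_trace by simp
qed

lemma multiplicity_eq:
  "of_nat (multiplicity_in_std E \<A> rep) =
    of_nat (card E) * (- (of_nat k * of_nat (Suc l) * cheb t kl r)) / \<mu>"
proof -
  obtain D where D: "irreducible_decomposition E \<A> D"
    using irreducible_decomposition_exists[OF finite_E] by blast
  have "multiplicity_in_std E \<A> rep = card {W\<in>D. submodule_iso_rep E \<A> rep W}"
    unfolding multiplicity_in_std_def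
  proof (rule the_equality)
    show "\<exists>D'. irreducible_decomposition E \<A> D' \<and>
      card {W\<in>D. submodule_iso_rep E \<A> rep W} = card {W\<in>D'. submodule_iso_rep E \<A> rep W}"
      using D by blast
    fix m assume "\<exists>D'. irreducible_decomposition E \<A> D' \<and>
      m = card {W\<in>D'. submodule_iso_rep E \<A> rep W}"
    then obtain D' where "irreducible_decomposition E \<A> D'"
      "m = card {W\<in>D'. submodule_iso_rep E \<A> rep W}" by blast
    then have "(of_nat m :: complex) = of_nat (card {W\<in>D. submodule_iso_rep E \<A> rep W})"
      using card_summands D by simp
    then show "m = card {W\<in>D. submodule_iso_rep E \<A> rep W}" by (simp only: of_nat_eq_iff)
  qed
  then show ?thesis using card_summands[OF D] by simp
qed

lemma multiplicity_formula:
  assumes "k < l"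
  shows "of_nat (multiplicity_in_std E \<A> rep) =
    of_nat (card E) * ((t\<^sup>2 - 4 * of_nat k * of_nat l) /
      ((t - of_nat k * of_nat l - 1) * ((2 * of_nat r + 1) * \<theta> + of_nat l - of_nat k)))"
proof -
  define d where "d = (2 * of_nat r + 1) * \<theta> + of_nat l - of_nat k"
  define F' where "F' = F_deriv t kl (of_nat k) r"
  have "d \<noteq> 0"
  proof -
    obtain x where x: "x \<ge> 0" "\<theta> = of_real x" using \<theta>_nonneg by blast
    have "d = of_real ((2 * real r + 1) * x + (real l - real k))"
      unfolding d_def x(2) by simp
    moreover have "(2 * real r + 1) * x + (real l - real k) > 0"
      using x(1) assms by (intro add_nonneg_pos mult_nonneg_nonneg) simp_all
    ultimately show ?thesis by (simp only: of_real_eq_0_iff)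
  qed
  then have nonzero: "(t - kl - 1) * of_nat (Suc l) * F' \<noteq> 0" "(t - kl - 1) * d \<noteq> 0"
    using \<mu>_nonzero unfolding \<mu>_def F'_def by auto
  have F': "(t\<^sup>2 - 4 * of_nat k * of_nat l) * F' = - (of_nat k * cheb t kl r * d)"
    using F_deriv_at_root[OF root] by (simp add: d_def F'_def)
  \<comment> \<open>Comparing the fractions by cross multiplication avoids a division by the
    discriminant or by the Chebyshev value.\<close>
  have "- (of_nat k * of_nat (Suc l) * cheb t kl r) * ((t - kl - 1) * d) =
      (t - kl - 1) * of_nat (Suc l) * - (of_nat k * cheb t kl r * d)"
    by (simp only: mult_minus_left mult_minus_right mult_ac)
  also have "\<dots> = (t\<^sup>2 - 4 * of_nat k * of_nat l) * ((t - kl - 1) * of_nat (Suc l) * F')"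
    unfolding F'[symmetric] by (simp only: mult_ac)
  finally have "- (of_nat k * of_nat (Suc l) * cheb t kl r) / \<mu> =
      (t\<^sup>2 - 4 * of_nat k * of_nat l) / ((t - kl - 1) * d)"
    unfolding \<mu>_def F'_def[symmetric] frac_eq_eq[OF nonzero] .
  then show ?thesis unfolding multiplicity_eq d_def[symmetric] by (simp only: times_divide_eq_right[symmetric])
qed

end


section \<open>Unbalanced distance-biregular graphs of girth deficiency two\<close>

context bipartite_graph
begin

lemma ecc_ge: "u \<in> V \<Longrightarrow> v \<in> V \<Longrightarrow> gdist E u v \<le> ecc V E u"
  unfolding ecc_def using finite_V by (intro Max_ge) auto

lemma ecc_attained: "u \<in> V \<Longrightarrow> \<exists>v\<in>V. gdist E u v = ecc V E u"
  using Max_in[of "gdist E u ` V"] finite_V unfolding ecc_def by fastforce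

lemma class_ecc_ge: "C \<subseteq> V \<Longrightarrow> u \<in> C \<Longrightarrow> ecc V E u \<le> class_ecc V E C"
  unfolding class_ecc_def using finite_V by (intro Max_ge) (auto dest: finite_subset)

lemma diameter_attained: "\<exists>u\<in>V. ecc V E u = graph_diameter V E"
  using Max_in[of "ecc V E ` V"] finite_V conn
  unfolding graph_diameter_def connected_graph_def by fastforce

lemma ecc_le_diameter: "u \<in> V \<Longrightarrow> ecc V E u \<le> graph_diameter V E"
  unfolding graph_diameter_def using finite_V by (intro Max_ge) auto

text \<open>The edges from \<open>v\<close> to its neighbours, followed by geodesics to \<open>b\<close>, arrive at \<open>b\<close>
  through pairwise different neighbours of \<open>b\<close>.\<close>

lemma card_nbrs_le:
  assumes girth: "enat (4 * r) < girth E" and b: "b \<in> V" and v: "v \<in> V"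
    and dist: "gdist E b v = Suc (2 * r)" "\<And>w. w \<in> nbrs E v \<Longrightarrow> gdist E b w = 2 * r" and "r > 0"
  shows "card (nbrs E v) \<le> card {w\<in>nbrs E b. gdist E w v \<le> 2 * r}"
proof -
  have pred: "\<exists>x. {b, x} \<in> E \<and> Suc (gdist E x w) = 2 * r" if w: "w \<in> nbrs E v" for w
  proof -
    have "w \<in> V" using w edge_in_V by (auto simp: nbrs_def)
    moreover have "b \<noteq> w" using dist(2)[OF w] \<open>r > 0\<close> by auto
    ultimately show ?thesis using gdist_pred[OF b] dist(2)[OF w] by metis
  qed
  then obtain f where f: "\<And>w. w \<in> nbrs E v \<Longrightarrow> {b, f w} \<in> E \<and> Suc (gdist E (f w) w) = 2 * r"
    by metis
  have fV: "f w \<in> V" if "w \<in> nbrs E v" for w using f[OF that] edge_in_V by blast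
  have le: "gdist E (f w) v \<le> 2 * r" if w: "w \<in> nbrs E v" for w
  proof -
    have "gdist E v (f w) \<le> Suc (gdist E w (f w))"
      using w gdist_edge fV by (simp add: nbrs_def)
    moreover have "w \<in> V" using w edge_in_V by (auto simp: nbrs_def)
    ultimately show ?thesis using f[OF w] gdist_commute fV[OF w] v by metis
  qed
  \<comment> \<open>The lower bound comes from the distance 2r + 1 of \<open>b\<close> and
    \<open>v\<close>. Hence \<open>w\<close> is one step closer to \<open>f w\<close> than
    \<open>v\<close> is, and \<open>unique_pred\<close> recovers \<open>w\<close> from
    \<open>f w\<close>.\<close>
  have eq: "gdist E v (f w) = 2 * r" if w: "w \<in> nbrs E v" for w
    using gdist_edge[of b "f w" v] f[OF w] v le[OF w] dist(1) gdist_commute[OF v fV[OF w]] by simp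
  have "inj_on f (nbrs E v)"
  proof (rule inj_onI)
    fix w w' assume w: "w \<in> nbrs E v" "w' \<in> nbrs E v" and same: "f w = f w'"
    have wV: "w \<in> V" "w' \<in> V" using w edge_in_V by (auto simp: nbrs_def)
    show "w = w'"
    proof (rule unique_pred[OF _ v fV[OF w(1)]])
      show "enat (2 * gdist E v (f w)) < girth E" using girth eq[OF w(1)] by simp
      show "{v, w} \<in> E" "{v, w'} \<in> E" using w by (auto simp: nbrs_def)
      show "Suc (gdist E w (f w)) = gdist E v (f w)" "Suc (gdist E w' (f w)) = gdist E v (f w)"
        using f[OF w(1)] f[OF w(2)] same eq[OF w(1)] gdist_commute wV fV[OF w(1)] by metis+
    qed
  qed
  moreover have "f ` nbrs E v \<subseteq> {w\<in>nbrs E b. gdist E w v \<le> 2 * r}"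
    using f le by (auto simp: nbrs_def)
  moreover have "finite {w\<in>nbrs E b. gdist E w v \<le> 2 * r}" using finite_nbrs by simp
  ultimately show ?thesis by (rule card_inj_on_le)
qed

end

theorem theorem5p8:
  fixes V A B :: "'v set" and E :: "'v set set"
    and r k l :: nat and t z :: complex
  assumes "distance_biregular V E A B"
    and "class_ecc V E B < class_ecc V E A"
    and "graph_diameter V E = 2 * r + 2" and "r \<ge> 1"
    and "girth_deficiency_two V E"
    and "\<forall>a\<in>A. degree_in E a = k + 1"
    and "\<forall>b\<in>B. degree_in E b = l + 1"
    and "poly (map_poly of_int (F_poly k l r)) t = 0"
    and "z\<^sup>2 = (1 + of_nat k * of_nat l - t) * (t + of_nat k + of_nat l) / (of_nat k + 1)\<^sup>2"
  shows "of_nat (multiplicity_in_std E (adj_algebra E A B) (assoc_rep E A B k l t z)) =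
    of_nat (card E) *
      ((t\<^sup>2 - 4 * of_nat k * of_nat l) /
       ((t - of_nat k * of_nat l - 1) *
        ((2 * of_nat r + 1) * (t + of_nat k + of_nat l) + of_nat l - of_nat k)))"
proof -
  interpret bipartite_graph V A B E
    using assms(1) by unfold_locales (simp_all add: distance_biregular_def)
  have girth: "girth E = enat (4 * r + 2)"
    using assms(3,5) by (simp add: girth_deficiency_two_def algebra_simps)
  then have girth_gt: "enat (4 * r) < girth E" by simp
  have subsets: "A \<subseteq> V" "B \<subseteq> V" using V_eq by auto
  \<comment> \<open>A finite girth yields a cycle, hence an edge and a vertex in \<open>A\<close>;
    the maximum defining \<open>class_ecc V E A\<close> is then attained.\<close>
  have "{c. is_cycle E c} \<noteq> {}"
  proof
    assume empty: "{c. is_cycle E c} = {}"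
    have "girth E = \<infinity>" unfolding girth_def empty by (simp add: top_enat_def)
    then show False using girth by simp
  qed
  then obtain c where "is_cycle E c" by blast
  then have "{last c, hd c} \<in> E" by (simp add: is_cycle_def)
  then have "A \<noteq> {}" using edge_ends(1) by force
  then have "class_ecc V E A \<in> ecc V E ` A"
    unfolding class_ecc_def using finite_V subsets by (intro Max_in) (auto dest: finite_subset)
  then have "class_ecc V E A \<le> 2 * r + 2" using ecc_le_diameter assms(3) subsets by auto
  then have ecc_B: "ecc V E b \<le> 2 * r + 1" if "b \<in> B" for b
    using class_ecc_ge[OF subsets(2) that] assms(2) by simp
  have dist_B: "gdist E u v \<le> 2 * r" if "u \<in> B" "v \<in> B" for u v
  proof -
    have uv: "u \<in> V" "v \<in> V" using that subsets by auto
    have "even (gdist E u v)" using gdist_parity[OF uv] that A_B_disjoint by blast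
    moreover have "gdist E u v \<le> 2 * r + 1"
      using ecc_ge[OF uv] ecc_B[OF that(1)] by simp
    ultimately show ?thesis by (metis dvd_triv_left even_plus_one_iff le_Suc_eq Suc_eq_plus1)
  qed
  have deg_A: "card (nbrs E a) = Suc k" if "a \<in> A" for a using assms(6) that by (simp add: card_nbrs)
  have deg_B: "card (nbrs E b) = Suc l" if "b \<in> B" for b using assms(7) that by (simp add: card_nbrs)
  obtain u v where uv: "u \<in> V" "v \<in> V" "gdist E u v = 2 * r + 2"
    using diameter_attained ecc_attained assms(3) by metis
  \<comment> \<open>Eccentricities in \<open>B\<close> are at most 2r + 1, so a pair at distance 2r
    + 2 lies in \<open>A\<close>.\<close>
  have "u \<in> A" using ecc_B[of u] ecc_ge[OF uv(1,2)] uv(1,3) V_eq by fastforce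
  then have "v \<in> A" using gdist_parity[OF uv(1,2)] uv(3) by simp
  have "u \<noteq> v" using uv(3) by auto
  then obtain b where b: "{u, b} \<in> E" "gdist E b v = Suc (2 * r)"
    using gdist_pred[OF uv(1,2)] uv(3) by auto
  have bV: "b \<in> V" using edge_in_V b by blast
  have bB: "b \<in> B" using edge_classes[OF b(1)] \<open>u \<in> A\<close> bV V_eq by blast
  \<comment> \<open>The distance from \<open>b\<close> is at least 2r because \<open>v\<close> is at
    distance 2r + 1, and at most 2r because both vertices lie in \<open>B\<close>.\<close>
  have nbr_v: "w \<in> B" "w \<in> V" "gdist E b w = 2 * r" if w: "w \<in> nbrs E v" for w
  proof -
    have vw: "{v, w} \<in> E" using w by (simp add: nbrs_def)
    show wV: "w \<in> V" using edge_in_V vw by blast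
    show wB: "w \<in> B" using edge_classes[OF vw] \<open>v \<in> A\<close> wV V_eq by blast
    have "gdist E v b \<le> Suc (gdist E w b)" using gdist_edge[OF vw bV] .
    then show "gdist E b w = 2 * r"
      using dist_B[OF bB wB] b(2) gdist_commute[OF bV uv(2)] gdist_commute[OF bV wV] by simp
  qed
  \<comment> \<open>The k + 1 neighbours of \<open>v\<close> inject into the l + 1 neighbours of
    \<open>b\<close>, and \<open>u\<close>, at distance 2r + 2 from \<open>v\<close>, is
    missed.\<close>
  have "card (nbrs E v) \<le> card {w\<in>nbrs E b. gdist E w v \<le> 2 * r}"
    using assms(4) by (intro card_nbrs_le girth_gt bV uv(2) b(2) nbr_v(3)) auto
  also have "{w\<in>nbrs E b. gdist E w v \<le> 2 * r} \<subseteq> nbrs E b - {u}" using uv(3) by auto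
  then have "card {w\<in>nbrs E b. gdist E w v \<le> 2 * r} \<le> card (nbrs E b - {u})"
    using finite_nbrs by (intro card_mono) auto
  also have "\<dots> = l" using deg_B[OF bB] b(1) by (simp add: nbrs_def insert_commute)
  finally have "k < l" using deg_A[OF \<open>v \<in> A\<close>] by simp
  \<comment> \<open>The second vertex of a geodesic from \<open>b\<close> to \<open>v\<close> lies
    in \<open>A\<close> and has two different neighbours on it, since the length 2r + 1 is at least
    3.\<close>
  have "k > 0"
  proof (rule ccontr)
    assume "\<not> k > 0"
    have "b \<noteq> v" using b(2) by auto
    then obtain a where a: "{b, a} \<in> E" "gdist E a v = 2 * r"
      using gdist_pred[OF bV uv(2)] b(2) by auto
    have aV: "a \<in> V" and aA: "a \<in> A"
      using edge_in_V[OF a(1)] edge_classes[OF a(1)] bB A_B_disjoint by blast+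
    have "a \<noteq> v" using a(2) assms(4) by auto
    then obtain b' where b': "{a, b'} \<in> E" "Suc (gdist E b' v) = 2 * r"
      using gdist_pred[OF aV uv(2)] a(2) by auto
    have "b \<in> nbrs E a" "b' \<in> nbrs E a" using a(1) b'(1) by (simp_all add: nbrs_def insert_commute)
    moreover have "card (nbrs E a) = 1" using deg_A[OF aA] \<open>\<not> k > 0\<close> by simp
    ultimately have "b = b'" by (metis card_1_singletonE singletonD)
    then show False using b(2) b'(2) by simp
  qed
  have "nbrs E v \<noteq> {}" using deg_A[OF \<open>v \<in> A\<close>] by force
  then have dist_ex: "\<exists>u\<in>B. \<exists>v\<in>B. gdist E u v = 2 * r" using nbr_v bB by blast
  interpret girth_biregular_rep V A B E r k l t z
  proof unfold_locales
    show "cheb t (of_nat k * of_nat l) (Suc r) + of_nat k * cheb t (of_nat k * of_nat l) r = 0"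
      using assms(8) unfolding poly_F_poly .
    show "l > 0" using \<open>k < l\<close> by simp
  qed (use girth_gt deg_A deg_B dist_B dist_ex assms(4,9) \<open>k > 0\<close> in auto)
  show ?thesis by (rule multiplicity_formula[OF \<open>k < l\<close>])
qed

end
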